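(* Let $\Phi:\mathbb{R}\to\mathbb{R}$ be a symmetric (even) convex function of class $\mathcal{C}^2$ for which there exist $M>0$ and $0<\varepsilon\leq 1/2$ such that $\Phi(M)>0$ and $$\forall x\geq M,\quad (1+\varepsilon)\Phi(x)\leq x\Phi'(x)\leq (2-\varepsilon)\Phi(x).$$ Let $\mu_\Phi(dx)=\frac{1}{Z_\Phi}e^{-\Phi(x)}dx$ with $Z_\Phi=\int_{\mathbb{R}} e^{-\Phi(x)}dx$. Then there exist constants $A,B,D\geq 0$ such that for every smooth function $f>0$ on $\mathbb{R}$, $$\mathbf{Ent}_{\mu_\Phi}(f^2)\leq A\int H_\Phi\left(\frac{f'}{f}\right)f^2\,d\mu_\Phi,$$ where $$H_\Phi(x)=\begin{cases}\Phi^*(Bx)&\text{if }|x|>D,\\ x^2&\text{if }|x|\leq D.\end{cases}$$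
   Context: $\Phi^*(x)=\sup_{y\in\mathbb{R}}\{xy-\Phi(y)\}$ is the Legendre–Fenchel transform of $\Phi$. For a probability measure $\mu$, $\mathbf{Ent}_\mu(f^2)=\int f^2\log f^2\,d\mu-\int f^2\,d\mu\,\log\int f^2\,d\mu$. "Smooth function" means a locally absolutely continuous function on $\mathbb{R}$. The convention $0\cdot\infty=0$ is used. The growth hypothesis on $\Phi$ ensures $Z_\Phi<\infty$. *)

theory Defs
  imports "HOL-Analysis.Analysis"
begin

definition absolutely_continuous_fun_on :: "real \<Rightarrow> real \<Rightarrow> (real \<Rightarrow> real) \<Rightarrow> bool" where
  "absolutely_continuous_fun_on a b f \<longleftrightarrow>
     (\<forall>e>0. \<exists>d>0. \<forall>(n::nat) (l::nat \<Rightarrow> real) (u::nat \<Rightarrow> real).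
        (\<forall>i<n. a \<le> l i \<and> l i \<le> u i \<and> u i \<le> b) \<and>
        disjoint_family_on (\<lambda>i. {l i<..<u i}) {..<n} \<and>
        (\<Sum>i<n. u i - l i) < d
        \<longrightarrow> (\<Sum>i<n. \<bar>f (u i) - f (l i)\<bar>) < e)"

definition locally_absolutely_continuous :: "(real \<Rightarrow> real) \<Rightarrow> bool" where
  "locally_absolutely_continuous f \<longleftrightarrow> (\<forall>a b. absolutely_continuous_fun_on a b f)"

definition legendre_fenchel :: "(real \<Rightarrow> real) \<Rightarrow> real \<Rightarrow> ereal" where
  "legendre_fenchel \<Phi> x = (SUP y. ereal (x * y - \<Phi> y))"

definition H_fun :: "(real \<Rightarrow> real) \<Rightarrow> real \<Rightarrow> real \<Rightarrow> real \<Rightarrow> ereal" where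
  "H_fun \<Phi> B D x = (if \<bar>x\<bar> > D then legendre_fenchel \<Phi> (B * x) else ereal (x\<^sup>2))"

definition Z_const :: "(real \<Rightarrow> real) \<Rightarrow> real" where
  "Z_const \<Phi> = (\<integral>x. exp (- \<Phi> x) \<partial>lborel)"

definition mu_measure :: "(real \<Rightarrow> real) \<Rightarrow> real measure" where
  "mu_measure \<Phi> = density lborel (\<lambda>x. ennreal (exp (- \<Phi> x) / Z_const \<Phi>))"

text \<open>
  Entropy of a nonnegative function under a probability measure. Since \<open>t ln t\<close> is bounded below,
  the entropy is finite exactly when \<open>g\<close> and \<open>g ln g\<close> are integrable; otherwise it is
  \<open>\<infinity>\<close>, by the usual convention if \<open>g\<close> itself is not integrable.
\<close>
definition Ent :: "'a measure \<Rightarrow> ('a \<Rightarrow> real) \<Rightarrow> ereal" where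
  "Ent M g =
     (if integrable M g \<and> integrable M (\<lambda>x. g x * ln (g x))
      then ereal ((\<integral>x. g x * ln (g x) \<partial>M) - (\<integral>x. g x \<partial>M) * ln (\<integral>x. g x \<partial>M))
      else \<infinity>)"

text \<open>
  Integral of an extended-real function as positive part minus negative part. On \<open>ereal\<close> one has
  \<open>\<infinity> - \<infinity> = \<infinity>\<close>, which would make an upper bound by an undefined integral vacuous; such integrals
  are therefore given the value \<open>-\<infinity>\<close>.
\<close>
definition ereal_integral :: "'a measure \<Rightarrow> ('a \<Rightarrow> ereal) \<Rightarrow> ereal" where
  "ereal_integral M g =
     (if (\<integral>\<^sup>+x. e2ennreal (- g x) \<partial>M) = \<infinity> then -\<infinity>
      else enn2ereal (\<integral>\<^sup>+x. e2ennreal (g x) \<partial>M) - enn2ereal (\<integral>\<^sup>+x. e2ennreal (- g x) \<partial>M))"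

end

theory Submission
  imports Defs
begin

text \<open>
  The inequality follows from elementary estimates, obtained by integrating by parts against the
  weight \<open>w = exp (- \<Phi>) / Z\<close>. Write \<open>I\<close> for the energy, that is, the integral of
  \<open>H (f' / f) f\<^sup>2\<close>, and suppose that \<open>I\<close> is finite and, by homogeneity, that \<open>f\<^sup>2\<close> has
  integral 1.

  Since \<open>\<Phi>\<close> grows at most quadratically, its Legendre transform grows at least quadratically, so
  \<open>H\<close> dominates a multiple of the square and \<open>I\<close> dominates the integral of \<open>f'\<^sup>2\<close>. The Poincare
  inequality (\<open>poincare_origin\<close>) then bounds the integral of \<open>(f - 1)\<^sup>2\<close> by \<open>I\<close>
  (\<open>distance_to_one\<close>). Where \<open>f \<le> 4\<close>, the entropy density \<open>f\<^sup>2 ln f\<^sup>2\<close> exceeds \<open>f\<^sup>2 - 1\<close> by at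
  most \<open>9 (f - 1)\<^sup>2\<close>, and \<open>f\<^sup>2 - 1\<close> has integral zero. Where \<open>f > 2\<close>, the square of \<open>f\<close> is at
  most \<open>4 (f - 1)\<^sup>2\<close>, so that errors proportional to the mass of that region are harmless.

  It remains to integrate \<open>f\<^sup>2 ln f\<^sup>2\<close> over the region \<open>f > 4\<close>. There one replaces \<open>f\<^sup>2\<close> by
  \<open>G = f\<^sup>2 u ^ (k + 1)\<close>, with a cutoff \<open>u\<close> between 0 and 1 that vanishes for \<open>f \<le> 2\<close> and is at
  least 1/2 for \<open>f > 4\<close>. Up to constants, \<open>ln f\<^sup>2\<close> is at most \<open>ln (G w) + \<Phi>\<close>. The vector field
  \<open>x\<close> controls the integral of \<open>G x \<Phi>'\<close> and hence of \<open>G \<Phi>\<close> (\<open>moment_bound\<close>): Young's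
  inequality splits \<open>x f' / f\<close> into a small multiple of the potential, which is absorbed, and the
  Legendre transform of \<open>f' / f\<close>. The cutoff costs one factor \<open>u\<close>; the lower growth exponent
  \<open>1 + \<epsilon>\<close> regains it, because \<open>\<Phi> (u ^ k x)\<close> is at most \<open>u ^ (k + 1) \<Phi> x\<close> when \<open>k \<epsilon> \<ge> 1\<close>
  (\<open>young_cut\<close>). Finally \<open>ln (G w) \<le> G w\<close>, and a density on the line is at most its total
  variation, which the preceding estimates bound by a multiple of \<open>I\<close> (\<open>density_bound\<close>).
  Because the mass is at most 1, this closes the argument.

  These computations require calculus for absolutely continuous functions: they are differentiable
  almost everywhere (\<open>locally_absolutely_continuous_AE_differentiable\<close>, by Vitali's covering
  theorem) and they are integrals of their derivatives (\<open>absolutely_continuous_has_integral\<close>).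
\<close>

section \<open>Absolutely continuous functions and their integrals\<close>

text \<open>
  The intervals may be indexed by any finite set. This is applied to divisions, where the index is
  the interval, and to tagged divisions, where one interval may occur with several tags.
\<close>
lemma absolutely_continuous_fun_on_indexed:
  assumes "absolutely_continuous_fun_on a b f" "0 < e"
  obtains d where "0 < d"
    "\<And>(I::'i set) l u. finite I \<Longrightarrow> (\<And>i. i \<in> I \<Longrightarrow> a \<le> l i \<and> l i \<le> u i \<and> u i \<le> b) \<Longrightarrow>
       disjoint_family_on (\<lambda>i. {l i<..<u i}) I \<Longrightarrow> (\<Sum>i\<in>I. u i - l i) < d \<Longrightarrow>
       (\<Sum>i\<in>I. \<bar>f (u i) - f (l i)\<bar>) < e"
proof -
  obtain d where d: "0 < d"
    "\<And>(n::nat) l u. (\<forall>i<n. a \<le> l i \<and> l i \<le> u i \<and> u i \<le> b) \<and>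
        disjoint_family_on (\<lambda>i. {l i<..<u i}) {..<n} \<and> (\<Sum>i<n. u i - l i) < d
        \<Longrightarrow> (\<Sum>i<n. \<bar>f (u i) - f (l i)\<bar>) < e"
    using assms(1)[unfolded absolutely_continuous_fun_on_def, rule_format, OF assms(2)] by blast
  have "(\<Sum>i\<in>I. \<bar>f (u i) - f (l i)\<bar>) < e"
    if I: "finite I" "\<And>i. i \<in> I \<Longrightarrow> a \<le> l i \<and> l i \<le> u i \<and> u i \<le> b"
      "disjoint_family_on (\<lambda>i. {l i<..<u i}) I" "(\<Sum>i\<in>I. u i - l i) < d"
    for I :: "'i set" and l u
  proof -
    obtain h where h: "bij_betw h {..<card I} I"
      using ex_bij_betw_nat_finite[OF I(1)] by (auto simp: atLeast0LessThan)
    have mem: "h i \<in> I" if "i < card I" for i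
      using bij_betwE[OF h] that by auto
    have "disjoint_family_on (\<lambda>i. {l (h i)<..<u (h i)}) {..<card I}"
      unfolding disjoint_family_on_def
    proof (intro ballI impI)
      fix i j assume ij: "i \<in> {..<card I}" "j \<in> {..<card I}" "i \<noteq> j"
      then have "h i \<noteq> h j" using bij_betw_imp_inj_on[OF h] by (auto dest: inj_onD)
      then show "{l (h i)<..<u (h i)} \<inter> {l (h j)<..<u (h j)} = {}"
        using I(3) mem ij unfolding disjoint_family_on_def by blast
    qed
    moreover have "(\<Sum>i<card I. u (h i) - l (h i)) = (\<Sum>i\<in>I. u i - l i)"
      using sum.reindex_bij_betw[OF h] .
    moreover have "(\<Sum>i<card I. \<bar>f (u (h i)) - f (l (h i))\<bar>) = (\<Sum>i\<in>I. \<bar>f (u i) - f (l i)\<bar>)"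
      using sum.reindex_bij_betw[OF h, of "\<lambda>i. \<bar>f (u i) - f (l i)\<bar>"] .
    ultimately show ?thesis
      using d(2)[of "card I" "\<lambda>i. l (h i)" "\<lambda>i. u (h i)"] I(2,4) mem by simp
  qed
  with d(1) show thesis using that by blast
qed

lemma absolutely_continuous_fun_on_imp_continuous:
  assumes "absolutely_continuous_fun_on a b f"
  shows "continuous_on {a..b} f"
  unfolding continuous_on_iff
proof (intro ballI allI impI)
  fix x e :: real
  assume x: "x \<in> {a..b}" and "0 < e"
  obtain d where d: "0 < d"
    "\<And>(I::unit set) l u. finite I \<Longrightarrow> (\<And>i. i \<in> I \<Longrightarrow> a \<le> l i \<and> l i \<le> u i \<and> u i \<le> b) \<Longrightarrow>
       disjoint_family_on (\<lambda>i. {l i<..<u i}) I \<Longrightarrow> (\<Sum>i\<in>I. u i - l i) < d \<Longrightarrow>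
       (\<Sum>i\<in>I. \<bar>f (u i) - f (l i)\<bar>) < e"
    using absolutely_continuous_fun_on_indexed[OF assms \<open>0 < e\<close>] by blast
  have "\<bar>f y - f x\<bar> < e" if y: "y \<in> {a..b}" "dist y x < d" for y
    using d(2)[of "{()}" "\<lambda>_. min x y" "\<lambda>_. max x y"] x y
    by (cases "x \<le> y") (auto simp: disjoint_family_on_def dist_real_def abs_minus_commute)
  then show "\<exists>d>0. \<forall>x'\<in>{a..b}. dist x' x < d \<longrightarrow> dist (f x') (f x) < e"
    using d(1) by (auto simp: dist_real_def)
qed

lemma locally_absolutely_continuous_imp_continuous:
  assumes "locally_absolutely_continuous f"
  shows "continuous_on UNIV f"
proof -
  have "isCont f x" for x
    using absolutely_continuous_fun_on_imp_continuous[of "x - 1" "x + 1" f] assms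
      continuous_on_interior[of "{x-1..x+1}" f x]
    by (auto simp: locally_absolutely_continuous_def)
  then show ?thesis by (simp add: continuous_at_imp_continuous_on)
qed

text \<open>
  The fundamental theorem of calculus for absolutely continuous functions. A gauge that straddles
  each point of differentiability controls the Riemann sums there, and on the exceptional null set
  the gauge keeps the intervals inside an open set of small measure, where absolute continuity
  makes the increments of the function small.
\<close>
lemma absolutely_continuous_has_integral:
  fixes f f' :: "real \<Rightarrow> real"
  assumes ac: "absolutely_continuous_fun_on a b f" and "a \<le> b"
    and der: "AE x in lborel. (f has_real_derivative f' x) (at x)"
  shows "(f' has_integral f b - f a) {a..b}"
proof -
  define N where "N = {x. \<not> (f has_real_derivative f' x) (at x)}"
  have negN: "negligible N"
  proof -
    obtain N' where N': "N' \<in> null_sets lborel"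
      "\<And>x. x \<in> space lborel - N' \<Longrightarrow> (f has_real_derivative f' x) (at x)"
      using AE_E3[OF der] by metis
    then have "N \<subseteq> N'" unfolding N_def by auto
    moreover have "negligible N'"
      unfolding negligible_iff_null_sets by (rule null_sets_completionI[OF N'(1)])
    ultimately show ?thesis by (rule negligible_subset[rotated])
  qed
  define g where "g = (\<lambda>x. if x \<in> N then 0 else f' x)"
  have "(g has_integral f b - f a) {a..b}"
    unfolding has_integral_real
  proof (intro allI impI)
    fix e :: real assume "0 < e"
    \<comment> \<open>The summand 1 keeps the denominator positive when the interval is a point.\<close>
    define c where "c = e / (2 * (b - a + 1))"
    have c: "0 < c" "c * (b - a) \<le> e/2"
      using \<open>0 < e\<close> \<open>a \<le> b\<close> by (auto simp: c_def field_simps)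
    obtain d where d: "0 < d"
      "\<And>(I::(real \<times> real set) set) l u. finite I \<Longrightarrow>
         (\<And>i. i \<in> I \<Longrightarrow> a \<le> l i \<and> l i \<le> u i \<and> u i \<le> b) \<Longrightarrow>
         disjoint_family_on (\<lambda>i. {l i<..<u i}) I \<Longrightarrow> (\<Sum>i\<in>I. u i - l i) < d \<Longrightarrow>
         (\<Sum>i\<in>I. \<bar>f (u i) - f (l i)\<bar>) < e/2"
      using absolutely_continuous_fun_on_indexed[OF ac half_gt_zero[OF \<open>0 < e\<close>]] by blast
    obtain U where U: "open U" "N \<subseteq> U" "U - N \<in> lmeasurable" "emeasure lebesgue (U - N) < ennreal d"
      using sets_lebesgue_outer_open[OF negligible_imp_sets[OF negN] d(1)] by metis
    have Um: "U \<in> lmeasurable" "measure lebesgue U < d"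
    proof -
      have *: "U = (U - N) \<union> N" using U by auto
      show "U \<in> lmeasurable"
        using fmeasurable.Un[OF U(3) negligible_imp_measurable[OF negN]] * by simp
      have "measure lebesgue U = measure lebesgue (U - N)"
        using negN \<open>U \<in> lmeasurable\<close> by (simp add: measure_Diff_null_set negligible_iff_null_sets fmeasurableD)
      also have "\<dots> < d"
        using U(3,4) d(1) by (simp add: emeasure_eq_measure2 ennreal_less_iff)
      finally show "measure lebesgue U < d" .
    qed
    have "\<exists>r>0. \<forall>y. \<bar>y - x\<bar> < r \<longrightarrow> \<bar>f y - f x - f' x * (y - x)\<bar> \<le> c * \<bar>y - x\<bar>" if "x \<notin> N" for x
    proof -
      have "(f has_derivative (\<lambda>h. f' x * h)) (at x)"
        using that by (simp add: N_def has_field_derivative_def)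
      then show ?thesis using c(1) unfolding has_derivative_at_alt by (simp add: real_norm_def)
    qed
    then obtain r where r: "\<And>x. x \<notin> N \<Longrightarrow> 0 < r x"
      "\<And>x y. x \<notin> N \<Longrightarrow> \<bar>y - x\<bar> < r x \<Longrightarrow> \<bar>f y - f x - f' x * (y - x)\<bar> \<le> c * \<bar>y - x\<bar>"
      by metis
    define \<gamma> where "\<gamma> = (\<lambda>x. if x \<in> N then U else ball x (r x))"
    have "gauge \<gamma>" using U r by (auto simp: gauge_def \<gamma>_def)
    moreover have "norm ((\<Sum>(x, k)\<in>p. measure lborel k *\<^sub>R g x) - (f b - f a)) < e"
      if p: "p tagged_division_of {a..b}" "\<gamma> fine p" for p
    proof -
      note pD = tagged_division_ofD[OF p(1)]
      have fin: "finite p" by fact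
      have iv: "\<exists>l u. k = {l..u} \<and> l \<le> u \<and> a \<le> l \<and> u \<le> b \<and> l \<le> x \<and> x \<le> u" if xk: "(x,k) \<in> p" for x k
        using pD(2-4)[OF xk] by fastforce
      have ivb: "a \<le> Inf k \<and> Inf k \<le> Sup k \<and> Sup k \<le> b \<and> Inf k \<le> x \<and> x \<le> Sup k
          \<and> k = {Inf k..Sup k} \<and> measure lborel k = Sup k - Inf k" if xk: "(x,k) \<in> p" for x k
        using iv[OF xk] by auto
      have good: "\<bar>measure lborel k * g x - (f (Sup k) - f (Inf k))\<bar> \<le> c * measure lborel k"
        if xk: "(x,k) \<in> p" "x \<notin> N" for x k
      proof -
        have k: "k \<subseteq> ball x (r x)" using fineD[OF p(2) xk(1)] xk(2) by (simp add: \<gamma>_def)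
        then have "Sup k \<in> ball x (r x)" "Inf k \<in> ball x (r x)"
          using ivb[OF xk(1)] by (metis atLeastAtMost_iff order_refl subsetD)+
        then have close: "\<bar>Sup k - x\<bar> < r x" "\<bar>Inf k - x\<bar> < r x"
          by (auto simp: dist_real_def)
        have ends: "Inf k \<le> x" "x \<le> Sup k" "measure lborel k = Sup k - Inf k"
          using ivb[OF xk(1)] by auto
        have "measure lborel k * g x - (f (Sup k) - f (Inf k))
            = (f (Inf k) - f x - f' x * (Inf k - x)) - (f (Sup k) - f x - f' x * (Sup k - x))"
          using xk(2) unfolding ends(3) g_def by (simp add: algebra_simps)
        also have "\<bar>\<dots>\<bar> \<le> c * \<bar>Inf k - x\<bar> + c * \<bar>Sup k - x\<bar>"
          using r(2)[OF xk(2) close(1)] r(2)[OF xk(2) close(2)] by linarith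
        also have "\<dots> = c * measure lborel k"
          unfolding ends(3) using ends(1,2) by (simp add: algebra_simps)
        finally show ?thesis .
      qed
      have bad: "(\<Sum>(x,k)\<in>{(x,k)\<in>p. x \<in> N}. \<bar>f (Sup k) - f (Inf k)\<bar>) < e/2"
      proof -
        let ?q = "{(x,k)\<in>p. x \<in> N}"
        have q: "?q \<subseteq> p" by auto
        have "?q tagged_partial_division_of {a..b}"
          using tagged_partial_division_subset[OF _ q] p(1) tagged_division_of_def by blast
        then have qt: "?q tagged_division_of (\<Union>(snd ` ?q))"
          by (rule tagged_partial_division_of_Union_self)
        then have qd: "(snd ` ?q) division_of (\<Union>(snd ` ?q))"
          by (rule division_of_tagged_division)
        have "(\<Sum>i\<in>?q. Sup (snd i) - Inf (snd i)) = (\<Sum>(x,k)\<in>?q. measure lborel k)"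
          by (rule sum.cong) (use ivb in auto)
        also have "\<dots> = sum (measure lborel) (snd ` ?q)"
          by (rule sum.over_tagged_division_lemma[OF qt]) (simp add: content_eq_0_interior)
        also have "\<dots> = (\<Sum>k\<in>snd ` ?q. measure lebesgue k)"
        proof (rule sum.cong)
          fix k assume "k \<in> snd ` ?q"
          then obtain x where "(x,k) \<in> p" by auto
          then show "measure lborel k = measure lebesgue k" using ivb[of x k] by (metis
                atLeastAtMost_borel measure_completion sets_lborel)
        qed auto
        also have "\<dots> = measure lebesgue (\<Union>(snd ` ?q))"
          by (rule content_division[OF qd])
        also have "\<dots> \<le> measure lebesgue U"
        proof (rule measure_mono_fmeasurable)
          have "k \<subseteq> U" if "(x,k) \<in> p" "x \<in> N" for x k
            using fineD[OF p(2) that(1)] that(2) by (simp add: \<gamma>_def)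
          then show "\<Union>(snd ` ?q) \<subseteq> U" by fastforce
          show "\<Union>(snd ` ?q) \<in> sets lebesgue" using lmeasurable_division[OF qd] by auto
        qed fact
        finally have "(\<Sum>i\<in>?q. Sup (snd i) - Inf (snd i)) < d" using Um by simp
        moreover have "disjoint_family_on (\<lambda>i. {Inf (snd i)<..<Sup (snd i)}) ?q"
          unfolding disjoint_family_on_def
        proof (intro ballI impI)
          fix i j assume ij: "i \<in> ?q" "j \<in> ?q" "i \<noteq> j"
          then have "interior (snd i) \<inter> interior (snd j) = {}"
            using pD(5)[of "fst i" "snd i" "fst j" "snd j"] by auto
          moreover have "interior (snd i) = {Inf (snd i)<..<Sup (snd i)}"
            "interior (snd j) = {Inf (snd j)<..<Sup (snd j)}"
            using ivb[of "fst i" "snd i"] ivb[of "fst j" "snd j"] ij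
            by (metis (no_types, lifting) case_prodD case_prod_unfold interior_atLeastAtMost_real mem_Collect_eq prod.collapse)+
          ultimately show "{Inf (snd i)<..<Sup (snd i)} \<inter> {Inf (snd j)<..<Sup (snd j)} = {}" by simp
        qed
        ultimately have "(\<Sum>i\<in>?q. \<bar>f (Sup (snd i)) - f (Inf (snd i))\<bar>) < e/2"
          using ivb finite_subset[OF q fin] by (intro d(2)) auto
        then show ?thesis by (simp add: case_prod_unfold)
      qed
      have "(\<Sum>(x, k)\<in>p. measure lborel k *\<^sub>R g x) - (f b - f a)
          = (\<Sum>(x,k)\<in>p. measure lborel k * g x - (f (Sup k) - f (Inf k)))"
        using additive_tagged_division_1[OF \<open>a \<le> b\<close> p(1), of f]
        by (simp add: case_prod_unfold sum_subtractf)
      also have "\<bar>\<dots>\<bar> \<le> (\<Sum>(x,k)\<in>p. \<bar>measure lborel k * g x - (f (Sup k) - f (Inf k))\<bar>)"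
        by (rule order_trans[OF sum_abs]) (simp add: case_prod_unfold)
      also have "\<dots> \<le> (\<Sum>(x,k)\<in>p. c * measure lborel k + (if x \<in> N then \<bar>f (Sup k) - f (Inf k)\<bar> else 0))"
      proof (rule sum_mono, clarify)
        fix x k assume xk: "(x,k) \<in> p"
        show "\<bar>measure lborel k * g x - (f (Sup k) - f (Inf k))\<bar>
          \<le> c * measure lborel k + (if x \<in> N then \<bar>f (Sup k) - f (Inf k)\<bar> else 0)"
          using good[OF xk] c(1) by (auto simp: g_def abs_minus_commute)
      qed
      also have "\<dots> = c * (\<Sum>(x,k)\<in>p. measure lborel k) + (\<Sum>(x,k)\<in>{(x,k)\<in>p. x \<in> N}. \<bar>f (Sup k) - f (Inf k)\<bar>)"
      proof -
        have *: "{(x,k)\<in>p. x \<in> N} = p \<inter> {i. fst i \<in> N}" by auto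
        show ?thesis unfolding *
          using fin by (simp add: case_prod_unfold sum.distrib sum_distrib_left sum.inter_restrict)
      qed
      also have "\<dots> = c * (b - a) + (\<Sum>(x,k)\<in>{(x,k)\<in>p. x \<in> N}. \<bar>f (Sup k) - f (Inf k)\<bar>)"
        using additive_content_tagged_division[of p a b] p(1) \<open>a \<le> b\<close> by simp
      also have "\<dots> < e" using bad c(2) by simp
      finally show ?thesis by simp
    qed
    ultimately show "\<exists>\<gamma>. gauge \<gamma> \<and> (\<forall>p. p tagged_division_of {a..b} \<and> \<gamma> fine p \<longrightarrow>
        norm ((\<Sum>(x, k)\<in>p. measure lborel k *\<^sub>R g x) - (f b - f a)) < e)"
      by (intro exI[of _ \<gamma>] conjI allI impI) auto
  qed
  then show ?thesis
    by (rule has_integral_spike[OF negN, rotated]) (auto simp: g_def)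
qed

section \<open>Variation and oscillation\<close>

text \<open>
  Sums, products and compositions with continuously differentiable functions all satisfy such a
  bound on a compact interval.
\<close>
lemma absolutely_continuous_fun_on_dominated:
  assumes F: "absolutely_continuous_fun_on a b F" and G: "absolutely_continuous_fun_on a b G"
    and dom: "\<And>s t. s \<in> {a..b} \<Longrightarrow> t \<in> {a..b} \<Longrightarrow> \<bar>Q t - Q s\<bar> \<le> L * (\<bar>F t - F s\<bar> + \<bar>G t - G s\<bar>)"
  shows "absolutely_continuous_fun_on a b Q"
  unfolding absolutely_continuous_fun_on_def
proof (intro allI impI)
  fix e :: real assume "0 < e"
  define K where "K = \<bar>L\<bar> + 1"
  have K: "0 < K" "L \<le> K" by (auto simp: K_def)
  define e' where "e' = e / (2 * K)"
  have e': "0 < e'" "K * (e' + e') = e" using \<open>0 < e\<close> K by (auto simp: e'_def field_simps)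
  obtain d1 where d1: "0 < d1"
    "\<And>(I::nat set) l u. finite I \<Longrightarrow> (\<And>i. i \<in> I \<Longrightarrow> a \<le> l i \<and> l i \<le> u i \<and> u i \<le> b) \<Longrightarrow>
       disjoint_family_on (\<lambda>i. {l i<..<u i}) I \<Longrightarrow> (\<Sum>i\<in>I. u i - l i) < d1 \<Longrightarrow>
       (\<Sum>i\<in>I. \<bar>F (u i) - F (l i)\<bar>) < e'"
    using absolutely_continuous_fun_on_indexed[OF F e'(1)] by blast
  obtain d2 where d2: "0 < d2"
    "\<And>(I::nat set) l u. finite I \<Longrightarrow> (\<And>i. i \<in> I \<Longrightarrow> a \<le> l i \<and> l i \<le> u i \<and> u i \<le> b) \<Longrightarrow>
       disjoint_family_on (\<lambda>i. {l i<..<u i}) I \<Longrightarrow> (\<Sum>i\<in>I. u i - l i) < d2 \<Longrightarrow>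
       (\<Sum>i\<in>I. \<bar>G (u i) - G (l i)\<bar>) < e'"
    using absolutely_continuous_fun_on_indexed[OF G e'(1)] by blast
  have "(\<Sum>i<n. \<bar>Q (u i) - Q (l i)\<bar>) < e"
    if A: "\<forall>i<n. a \<le> l i \<and> l i \<le> u i \<and> u i \<le> b" "disjoint_family_on (\<lambda>i. {l i<..<u i}) {..<n}"
      "(\<Sum>i<n. u i - l i) < min d1 d2" for n :: nat and l u
  proof -
    have "(\<Sum>i<n. \<bar>Q (u i) - Q (l i)\<bar>) \<le> (\<Sum>i<n. K * (\<bar>F (u i) - F (l i)\<bar> + \<bar>G (u i) - G (l i)\<bar>))"
    proof (rule sum_mono)
      fix i assume "i \<in> {..<n}"
      then have "\<bar>Q (u i) - Q (l i)\<bar> \<le> L * (\<bar>F (u i) - F (l i)\<bar> + \<bar>G (u i) - G (l i)\<bar>)"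
        using A(1) by (intro dom) force+
      also have "\<dots> \<le> K * (\<bar>F (u i) - F (l i)\<bar> + \<bar>G (u i) - G (l i)\<bar>)"
        using K by (intro mult_right_mono) auto
      finally show "\<bar>Q (u i) - Q (l i)\<bar> \<le> K * (\<bar>F (u i) - F (l i)\<bar> + \<bar>G (u i) - G (l i)\<bar>)" .
    qed
    also have "\<dots> = K * ((\<Sum>i<n. \<bar>F (u i) - F (l i)\<bar>) + (\<Sum>i<n. \<bar>G (u i) - G (l i)\<bar>))"
      by (simp only: sum_distrib_left sum.distrib[symmetric])
    also have "\<dots> < K * (e' + e')"
      using A d1(2)[of "{..<n}" l u] d2(2)[of "{..<n}" l u] K(1)
      by (intro mult_strict_left_mono add_strict_mono) auto
    finally show ?thesis using e' by simp
  qed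
  note small = this
  show "\<exists>d>0. \<forall>(n::nat) l u. (\<forall>i<n. a \<le> l i \<and> l i \<le> u i \<and> u i \<le> b) \<and>
      disjoint_family_on (\<lambda>i. {l i<..<u i}) {..<n} \<and> (\<Sum>i<n. u i - l i) < d
      \<longrightarrow> (\<Sum>i<n. \<bar>Q (u i) - Q (l i)\<bar>) < e"
  proof (intro exI conjI allI impI)
    show "0 < min d1 d2" using d1(1) d2(1) by simp
    fix n :: nat and l u
    assume "(\<forall>i<n. a \<le> l i \<and> l i \<le> u i \<and> u i \<le> b) \<and>
      disjoint_family_on (\<lambda>i. {l i<..<u i}) {..<n} \<and> (\<Sum>i<n. u i - l i) < min d1 d2"
    then show "(\<Sum>i<n. \<bar>Q (u i) - Q (l i)\<bar>) < e"
      by (intro small) auto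
  qed
qed

lemma absolutely_continuous_fun_on_ident: "absolutely_continuous_fun_on a b (\<lambda>x. x)"
  unfolding absolutely_continuous_fun_on_def
proof (intro allI impI)
  fix e :: real assume "0 < e"
  have "(\<Sum>i<n. \<bar>u i - l i\<bar>) = (\<Sum>i<n. u i - l i)" if "\<forall>i<n. a \<le> l i \<and> l i \<le> u i \<and> u i \<le> b"
    for n :: nat and l u :: "nat \<Rightarrow> real"
    using that by (intro sum.cong) auto
  then show "\<exists>d>0. \<forall>(n::nat) l u. (\<forall>i<n. a \<le> l i \<and> l i \<le> u i \<and> u i \<le> b) \<and>
      disjoint_family_on (\<lambda>i. {l i<..<u i}) {..<n} \<and> (\<Sum>i<n. u i - l i) < d
      \<longrightarrow> (\<Sum>i<n. \<bar>u i - l i\<bar>) < e"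
    using \<open>0 < e\<close> by (intro exI[of _ e]) auto
qed

lemma sum_increments_division:
  fixes f :: "real \<Rightarrow> real"
  assumes "a \<le> b" "d division_of {a..b}"
  shows "(\<Sum>k\<in>d. f (Sup k) - f (Inf k)) = f b - f a"
proof -
  let ?p = "(\<lambda>k. (Inf k, k)) ` d"
  note D = division_ofD[OF assms(2)]
  have "?p tagged_division_of {a..b}"
  proof (rule tagged_division_ofI)
    show "finite ?p" using D(1) by simp
    show "x \<in> k" "k \<subseteq> {a..b}" "\<exists>a b. k = cbox a b" if "(x, k) \<in> ?p" for x k
      using that D(2-4)[of k] by auto
    show "interior k1 \<inter> interior k2 = {}" if "(x1,k1) \<in> ?p" "(x2,k2) \<in> ?p" "(x1,k1) \<noteq> (x2,k2)" for x1 k1 x2 k2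
      using that by (intro D(5)) auto
    have "{k. \<exists>x. (x, k) \<in> ?p} = d" by auto
    then show "\<Union>{k. \<exists>x. (x, k) \<in> ?p} = {a..b}" using D(6) by simp
  qed
  from additive_tagged_division_1[OF assms(1) this, of f] show ?thesis
    by (simp add: sum.reindex inj_on_def)
qed

lemma division_interval_real:
  assumes "d division_of {a..b::real}" "k \<in> d"
  shows "k = {Inf k..Sup k}" "Inf k \<le> Sup k" "a \<le> Inf k" "Sup k \<le> b"
    "measure lebesgue k = Sup k - Inf k"
proof -
  obtain l u where "k = {l..u}" "l \<le> u" "a \<le> l" "u \<le> b"
    using division_ofD(2-4)[OF assms(1) assms(2)] by fastforce
  then show "k = {Inf k..Sup k}" "Inf k \<le> Sup k" "a \<le> Inf k" "Sup k \<le> b"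
    "measure lebesgue k = Sup k - Inf k" by auto
qed

text \<open>
  Vitali's covering theorem in one dimension: a set that is finely covered by intervals with some
  property is exhausted, up to arbitrarily little measure, by finitely many disjoint ones.
\<close>
lemma Vitali_covering_intervals:
  fixes S :: "real set"
  assumes S: "S \<in> lmeasurable" "S \<subseteq> {u<..<v}"
    and cov: "\<And>x d. x \<in> S \<Longrightarrow> 0 < d \<Longrightarrow> \<exists>s t. s < t \<and> s \<le> x \<and> x \<le> t \<and> t - s < d \<and> P s t"
    and \<theta>: "\<theta> < measure lebesgue S"
  obtains D where "finite D" "D division_of \<Union>D" "\<Union>D \<subseteq> {u..v}"
    "\<And>k. k \<in> D \<Longrightarrow> \<exists>s t. s < t \<and> k = {s..t} \<and> P s t" "\<theta> < (\<Sum>k\<in>D. measure lebesgue k)"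
proof -
  define K where "K = {(s,t). s < t \<and> u \<le> s \<and> t \<le> v \<and> P s t}"
  define m where "m = (\<lambda>(s::real,t::real). (s+t)/2)"
  define r where "r = (\<lambda>(s::real,t::real). (t-s)/2)"
  have cb: "cball (m i) (r i) = {fst i..snd i}" for i
    by (cases i) (auto simp: m_def r_def cball_def dist_real_def abs_le_iff field_simps)
  have r: "0 < r i" if "i \<in> K" for i using that by (auto simp: K_def r_def)
  have cov': "\<exists>i. i \<in> K \<and> x \<in> cball (m i) (r i) \<and> r i < d" if xd: "x \<in> S" "0 < d" for x d
  proof -
    define d' where "d' = min d (min (x - u) (v - x))"
    have "0 < d'" using xd S(2) by (auto simp: d'_def)
    then obtain s t where st: "s < t" "s \<le> x" "x \<le> t" "t - s < d'" "P s t"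
      using cov[OF xd(1)] by blast
    then have "(s,t) \<in> K" "x \<in> cball (m (s,t)) (r (s,t))" "r (s,t) < d"
      unfolding cb by (auto simp: K_def d'_def r_def)
    then show ?thesis by blast
  qed
  obtain C where C: "countable C" "C \<subseteq> K"
    "pairwise (\<lambda>i j. disjnt (cball (m i) (r i)) (cball (m j) (r j))) C"
    "negligible (S - (\<Union>i\<in>C. cball (m i) (r i)))"
    using Vitali_covering_theorem_cballs[of K r S m, OF r cov'] by blast
  have "\<exists>F. F \<subseteq> C \<and> finite F \<and> \<theta> < measure lebesgue (\<Union>i\<in>F. {fst i..snd i})"
  proof (rule ccontr)
    assume *: "\<not> ?thesis"
    then have bd: "measure lebesgue (\<Union>i\<in>F. {fst i..snd i}) \<le> \<theta>" if "F \<subseteq> C" "finite F" for F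
      using that by force
    have "(\<Union>i\<in>C. {fst i..snd i}) \<in> lmeasurable" "measure lebesgue (\<Union>i\<in>C. {fst i..snd i}) \<le> \<theta>"
      using fmeasurable_UN_bound[of C "\<lambda>i. {fst i..snd i}" lebesgue \<theta>]
        measure_UN_bound[of C "\<lambda>i. {fst i..snd i}" lebesgue \<theta>] C(1) bd by auto
    note U = this
    have "measure lebesgue S \<le> measure lebesgue (\<Union>i\<in>C. {fst i..snd i})"
    proof -
      let ?U = "\<Union>i\<in>C. {fst i..snd i}"
      have N: "S - ?U \<in> null_sets lebesgue" using C(4) by (simp add: cb negligible_iff_null_sets)
      have "measure lebesgue S \<le> measure lebesgue (?U \<union> (S - ?U))"
        using U(1) N S(1) by (intro measure_mono_fmeasurable) (auto intro: fmeasurable.Un negligible_imp_measurable simp: negligible_iff_null_sets)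
      also have "\<dots> = measure lebesgue ?U"
        by (rule measure_Un_null_set[OF fmeasurableD[OF U(1)] N])
      finally show ?thesis .
    qed
    then show False using \<theta> U(2) by linarith
  qed
  then obtain F where F: "F \<subseteq> C" "finite F" "\<theta> < measure lebesgue (\<Union>i\<in>F. {fst i..snd i})" by blast
  define D where "D = (\<lambda>i. {fst i..snd i}) ` F"
  have FK: "F \<subseteq> K" using F(1) C(2) by blast
  have div: "D division_of \<Union>D"
  proof (rule division_ofI)
    show "finite D" using F(2) by (simp add: D_def)
    show "k \<subseteq> \<Union>D" if "k \<in> D" for k using that by blast
    show "k \<noteq> {}" if "k \<in> D" for k using that FK by (force simp: D_def K_def)
    show "\<exists>a b. k = cbox a b" if "k \<in> D" for k using that by (auto simp: D_def)
    show "interior k1 \<inter> interior k2 = {}" if k: "k1 \<in> D" "k2 \<in> D" "k1 \<noteq> k2" for k1 k2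
    proof -
      obtain i j where ij: "i \<in> F" "j \<in> F" "k1 = {fst i..snd i}" "k2 = {fst j..snd j}"
        using k by (auto simp: D_def)
      then have "i \<in> C" "j \<in> C" "i \<noteq> j" using F(1) k(3) by auto
      then have "disjnt k1 k2"
        using pairwiseD[OF C(3), of i j] ij(3,4) by (simp add: cb)
      then show ?thesis using interior_subset unfolding disjnt_def by blast
    qed
  qed auto
  show thesis
  proof (rule that[OF _ div])
    show "finite D" using F(2) by (simp add: D_def)
    show "\<Union>D \<subseteq> {u..v}" using FK by (force simp: D_def K_def)
    show "\<exists>s t. s < t \<and> k = {s..t} \<and> P s t" if "k \<in> D" for k
    proof -
      obtain i where i: "i \<in> F" "k = {fst i..snd i}" using \<open>k \<in> D\<close> by (auto simp: D_def)
      then have "fst i < snd i" "P (fst i) (snd i)" using FK by (auto simp: K_def)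
      with i show ?thesis by blast
    qed
    show "\<theta> < (\<Sum>k\<in>D. measure lebesgue k)"
      using F(3) content_division[OF div] by (simp add: D_def)
  qed
qed

text \<open>
  Disjoint descending intervals that cover much of S must be compensated by ascents elsewhere if the
  function increases over the whole interval. Subdividing along them therefore raises the variation
  above the increment, in proportion to the measure of S.
\<close>
lemma division_gaining_variation:
  fixes g :: "real \<Rightarrow> real"
  assumes "u \<le> v" "g u \<le> g v" "0 < c" and S: "S \<in> lmeasurable" "S \<subseteq> {u<..<v}"
    and desc: "\<And>x d. x \<in> S \<Longrightarrow> 0 < d \<Longrightarrow>
      \<exists>s t. s < t \<and> s \<le> x \<and> x \<le> t \<and> t - s < d \<and> g t - g s \<le> - c * (t - s)"
  shows "\<exists>q. q division_of {u..v} \<and>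
    \<bar>g v - g u\<bar> + c * measure lebesgue S \<le> (\<Sum>k\<in>q. \<bar>g (Sup k) - g (Inf k)\<bar>)"
proof (cases "measure lebesgue S = 0")
  case True
  have "{{u..v}} division_of {u..v}" using \<open>u \<le> v\<close> division_of_self[of u v] by auto
  then show ?thesis using True \<open>u \<le> v\<close> by (intro exI[of _ "{{u..v}}"]) auto
next
  case False
  then have "measure lebesgue S / 2 < measure lebesgue S"
    using zero_less_measure_iff[of lebesgue S] by simp
  \<comment> \<open>It suffices to cover half of S: the covered length counts twice, once for the descent itself
      and once for the ascent that compensates it.\<close>
  from Vitali_covering_intervals[of S u v "\<lambda>s t. g t - g s \<le> - c * (t - s)", OF S desc this]
  obtain D where D: "finite D" "D division_of \<Union>D" "\<Union>D \<subseteq> {u..v}"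
    "\<And>k. k \<in> D \<Longrightarrow> \<exists>s t. s < t \<and> k = {s..t} \<and> g t - g s \<le> - c * (t - s)"
    "measure lebesgue S / 2 < (\<Sum>k\<in>D. measure lebesgue k)" by blast
  obtain q where q: "D \<subseteq> q" "q division_of {u..v}"
    using partial_division_extend_interval[OF D(2), of u v] D(3) by auto
  have fin: "finite q" using q(2) by auto
  let ?\<Delta> = "\<lambda>k. g (Sup k) - g (Inf k)"
  have Dk: "?\<Delta> k \<le> - c * measure lebesgue k" if "k \<in> D" for k
    using D(4)[OF that] by auto
  have "(\<Sum>k\<in>D. ?\<Delta> k) \<le> (\<Sum>k\<in>D. - c * measure lebesgue k)" by (rule sum_mono[OF Dk])
  also have "\<dots> = - c * (\<Sum>k\<in>D. measure lebesgue k)" by (simp add: sum_distrib_left)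
  also have "\<dots> \<le> - c * (measure lebesgue S / 2)" using D(5) \<open>0 < c\<close> by simp
  finally have le: "(\<Sum>k\<in>D. ?\<Delta> k) \<le> - c * (measure lebesgue S / 2)" .
  have "g v - g u = (\<Sum>k\<in>q - D. ?\<Delta> k) + (\<Sum>k\<in>D. ?\<Delta> k)"
    using sum_increments_division[OF \<open>u \<le> v\<close> q(2), of g] sum.subset_diff[OF q(1) fin, of ?\<Delta>] by simp
  also have "\<dots> \<le> (\<Sum>k\<in>q - D. \<bar>?\<Delta> k\<bar>) + (\<Sum>k\<in>D. ?\<Delta> k)"
    by (intro add_right_mono sum_mono) auto
  finally have "g v - g u \<le> (\<Sum>k\<in>q - D. \<bar>?\<Delta> k\<bar>) + (\<Sum>k\<in>D. ?\<Delta> k)" .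
  moreover have "- (\<Sum>k\<in>D. ?\<Delta> k) \<le> (\<Sum>k\<in>D. \<bar>?\<Delta> k\<bar>)"
    unfolding sum_negf[symmetric] by (intro sum_mono) auto
  moreover have "(\<Sum>k\<in>q. \<bar>?\<Delta> k\<bar>) = (\<Sum>k\<in>q - D. \<bar>?\<Delta> k\<bar>) + (\<Sum>k\<in>D. \<bar>?\<Delta> k\<bar>)"
    by (rule sum.subset_diff[OF q(1) fin])
  ultimately have "\<bar>g v - g u\<bar> + c * measure lebesgue S \<le> (\<Sum>k\<in>q. \<bar>?\<Delta> k\<bar>)"
    using le assms(2) by (simp add: algebra_simps)
  then show ?thesis using q(2) by blast
qed

text \<open>
  A function of bounded variation cannot oscillate on a set of positive measure. With T the total
  variation from the left end point and \<alpha> the measure of the part of S to the left of x, the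
  previous lemma gives that T - c \<alpha> still dominates the increments of the function; since T is the
  least such function, S is null.
\<close>
lemma negligible_oscillation_set:
  fixes g :: "real \<Rightarrow> real"
  assumes "a \<le> b" "0 < c"
    and bv: "\<And>d. d division_of {a..b} \<Longrightarrow> (\<Sum>k\<in>d. \<bar>g (Sup k) - g (Inf k)\<bar>) \<le> V"
    and S: "S \<in> sets lebesgue" "S \<subseteq> {a<..<b}"
    and asc: "\<And>x d. x \<in> S \<Longrightarrow> 0 < d \<Longrightarrow>
      \<exists>s t. s < t \<and> s \<le> x \<and> x \<le> t \<and> t - s < d \<and> c * (t - s) \<le> g t - g s"
    and desc: "\<And>x d. x \<in> S \<Longrightarrow> 0 < d \<Longrightarrow>
      \<exists>s t. s < t \<and> s \<le> x \<and> x \<le> t \<and> t - s < d \<and> g t - g s \<le> - c * (t - s)"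
  shows "negligible S"
proof -
  let ?var = "\<lambda>q. \<Sum>k\<in>q. \<bar>g (Sup k) - g (Inf k)\<bar>"
  define T where "T = (\<lambda>x. Sup {?var q |q. q division_of {a..x}})"
  define \<alpha> where "\<alpha> = (\<lambda>x. measure lebesgue (S \<inter> {a..x}))"
  have Sm: "S \<inter> X \<in> lmeasurable" if "X \<in> sets lebesgue" for X
  proof (rule fmeasurableI2[of "{a..b}"])
    show "S \<inter> X \<subseteq> {a..b}" using S(2) by fastforce
  qed (use S(1) that in auto)
  \<comment> \<open>The two divisions can share only degenerate intervals, on which the increment vanishes.\<close>
  have union: "p \<union> q division_of {a..v}" "?var (p \<union> q) = ?var p + ?var q"
    if pq: "p division_of {a..u}" "q division_of {u..v}" "a \<le> u" "u \<le> v" for p q u v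
  proof -
    have "interior {a..u} \<inter> interior {u..v} = {}" by auto
    moreover have "{a..u} \<union> {u..v} = {a..v}" using pq by auto
    ultimately show "p \<union> q division_of {a..v}"
      using division_disjoint_union[OF pq(1,2)] by simp
    have "Sup k = Inf k" if "k \<in> p \<inter> q" for k
      using division_interval_real[OF pq(1), of k] division_interval_real[OF pq(2), of k] that by auto
    then have "?var (p \<inter> q) = 0" by simp
    then show "?var (p \<union> q) = ?var p + ?var q"
      using sum.union_inter[of p q "\<lambda>k. \<bar>g (Sup k) - g (Inf k)\<bar>"] pq(1,2) by auto
  qed
  have triv: "{{u..v}} division_of {u..v}" if "u \<le> v" for u v :: real
    using that division_of_self[of u v] by auto
  have bdd: "bdd_above {?var q |q. q division_of {a..x}}" if "a \<le> x" "x \<le> b" for x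
  proof (rule bdd_aboveI[of _ V])
    fix y assume "y \<in> {?var q |q. q division_of {a..x}}"
    then obtain q where q: "q division_of {a..x}" "y = ?var q" by blast
    have "?var q + ?var {{x..b}} \<le> V"
      using bv[OF union(1)[OF q(1) triv]] union(2)[OF q(1) triv] that by simp
    moreover have "0 \<le> ?var {{x..b}}" by simp
    ultimately show "y \<le> V" using q(2) by linarith
  qed
  have T_ge: "?var q \<le> T x" if "q division_of {a..x}" "a \<le> x" "x \<le> b" for q x
    unfolding T_def by (rule cSup_upper) (use that bdd in auto)
  have gain: "\<exists>q. q division_of {u..v} \<and> \<bar>g v - g u\<bar> + c * measure lebesgue (S \<inter> {u<..<v}) \<le> ?var q"
    if "u \<le> v" for u v
  proof (cases "g u \<le> g v")
    case True
    show ?thesis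
      by (rule division_gaining_variation[OF that True \<open>0 < c\<close> Sm]) (use desc in auto)
  next
    case False
    have "\<exists>q. q division_of {u..v} \<and> \<bar>(- g v) - (- g u)\<bar> + c * measure lebesgue (S \<inter> {u<..<v})
        \<le> (\<Sum>k\<in>q. \<bar>(- g (Sup k)) - (- g (Inf k))\<bar>)"
    proof (rule division_gaining_variation[OF that _ \<open>0 < c\<close> Sm])
      fix x d :: real assume "x \<in> S \<inter> {u<..<v}" "0 < d"
      then show "\<exists>s t. s < t \<and> s \<le> x \<and> x \<le> t \<and> t - s < d \<and> - g t - - g s \<le> - c * (t - s)"
        using asc[of x d] by (auto simp: algebra_simps)
    qed (use False in auto)
    then show ?thesis by (simp add: abs_minus_commute)
  qed
  have Tinc: "\<bar>g v - g u\<bar> + c * measure lebesgue (S \<inter> {u<..<v}) \<le> T v - T u"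
    if uv: "a \<le> u" "u \<le> v" "v \<le> b" for u v
  proof -
    obtain q where q: "q division_of {u..v}" "\<bar>g v - g u\<bar> + c * measure lebesgue (S \<inter> {u<..<v}) \<le> ?var q"
      using gain[OF uv(2)] by blast
    have "Sup {?var q |q. q division_of {a..u}} \<le> T v - ?var q"
    proof (rule cSup_least)
      show "{?var q |q. q division_of {a..u}} \<noteq> {}" using triv[OF uv(1)] by blast
      fix y assume "y \<in> {?var q |q. q division_of {a..u}}"
      then obtain p where p: "p division_of {a..u}" "y = ?var p" by blast
      have "?var p + ?var q \<le> T v"
        using T_ge[OF union(1)[OF p(1) q(1)]] union(2)[OF p(1) q(1)] uv by simp
      then show "y \<le> T v - ?var q" using p(2) by simp
    qed
    then have "T u \<le> T v - ?var q" by (simp add: T_def)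
    then show ?thesis using q(2) by linarith
  qed
  have \<alpha>inc: "measure lebesgue (S \<inter> {u<..<v}) = \<alpha> v - \<alpha> u" if uv: "a \<le> u" "u \<le> v" for u v
  proof (cases "u = v")
    case False
    have N: "{v} \<in> null_sets lebesgue" by (simp add: negligible_iff_null_sets[symmetric])
    have "S \<inter> {a..v} - {v} = (S \<inter> {a..u}) \<union> (S \<inter> {u<..<v})" using uv False by auto
    then have "\<alpha> v = measure lebesgue ((S \<inter> {a..u}) \<union> (S \<inter> {u<..<v}))"
      using measure_Diff_null_set[OF fmeasurableD[OF Sm[of "{a..v}"]] N] by (simp add: \<alpha>_def)
    also have "\<dots> = \<alpha> u + measure lebesgue (S \<inter> {u<..<v})"
    proof -
      have "S \<inter> {u<..<v} - S \<inter> {a..u} = S \<inter> {u<..<v}" by auto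
      then show ?thesis
        using measure_Un2[OF Sm[of "{a..u}"] Sm[of "{u<..<v}"]] by (simp add: \<alpha>_def)
    qed
    finally show ?thesis by simp
  qed auto
  define W where "W = (\<lambda>x. T x - c * \<alpha> x)"
  have Winc: "\<bar>g v - g u\<bar> \<le> W v - W u" if uv: "a \<le> u" "u \<le> v" "v \<le> b" for u v
    using Tinc[OF uv] \<alpha>inc[OF uv(1,2)] by (simp add: W_def algebra_simps)
  have "Sup {?var q |q. q division_of {a..b}} \<le> W b - W a"
  proof (rule cSup_least)
    show "{?var q |q. q division_of {a..b}} \<noteq> {}" using triv[OF \<open>a \<le> b\<close>] by blast
    fix y assume "y \<in> {?var q |q. q division_of {a..b}}"
    then obtain q where q: "q division_of {a..b}" "y = ?var q" by blast
    have "?var q \<le> (\<Sum>k\<in>q. W (Sup k) - W (Inf k))"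
      by (rule sum_mono, rule Winc) (use division_interval_real[OF q(1)] in auto)
    also have "\<dots> = W b - W a" by (rule sum_increments_division[OF \<open>a \<le> b\<close> q(1)])
    finally show "y \<le> W b - W a" using q(2) by simp
  qed
  then have "T b \<le> W b - W a" by (simp add: T_def)
  moreover have "0 \<le> T a" using T_ge[OF triv[of a a]] \<open>a \<le> b\<close> by simp
  moreover have "\<alpha> a = 0" "\<alpha> b = measure lebesgue S"
  proof -
    have "S \<inter> {a..a} = {}" "S \<inter> {a..b} = S" using S(2) by auto
    then show "\<alpha> a = 0" "\<alpha> b = measure lebesgue S" by (simp_all add: \<alpha>_def)
  qed
  ultimately have "c * measure lebesgue S \<le> 0" by (simp add: W_def)
  then have "measure lebesgue S = 0"
    using \<open>0 < c\<close> by (metis measure_le_0_iff mult_le_cancel_left_pos mult_zero_right)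
  moreover have "S \<in> lmeasurable" using Sm[of UNIV] by simp
  ultimately show ?thesis by (simp add: negligible_iff_measure)
qed

section \<open>Differentiability almost everywhere\<close>

text \<open>
  Intervals with slopes above every bound at each point of a set of positive measure would make the
  variation infinite.
\<close>
lemma negligible_infinite_slope_set:
  fixes g :: "real \<Rightarrow> real"
  assumes bv: "\<And>d. d division_of {a..b} \<Longrightarrow> (\<Sum>k\<in>d. \<bar>g (Sup k) - g (Inf k)\<bar>) \<le> V"
    and S: "S \<in> sets lebesgue" "S \<subseteq> {a<..<b}"
    and steep: "\<And>x d N. x \<in> S \<Longrightarrow> 0 < d \<Longrightarrow>
      \<exists>s t. s < t \<and> s \<le> x \<and> x \<le> t \<and> t - s < d \<and> N * (t - s) \<le> \<bar>g t - g s\<bar>"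
  shows "negligible S"
proof -
  have Sm: "S \<in> lmeasurable"
    by (rule fmeasurableI2[of "{a..b}"]) (use S in \<open>auto simp: subset_iff less_imp_le\<close>)
  have "measure lebesgue S = 0"
  proof (rule ccontr)
    assume "measure lebesgue S \<noteq> 0"
    then have m: "0 < measure lebesgue S" using zero_less_measure_iff by blast
    define N where "N = 2 * (\<bar>V\<bar> + 1) / measure lebesgue S"
    have N: "0 < N" "N * (measure lebesgue S / 2) = \<bar>V\<bar> + 1" using m by (auto simp: N_def)
    have "measure lebesgue S / 2 < measure lebesgue S" using m by simp
    from Vitali_covering_intervals[of S a b "\<lambda>s t. N * (t - s) \<le> \<bar>g t - g s\<bar>", OF Sm S(2) steep this]
    obtain D where D: "finite D" "D division_of \<Union>D" "\<Union>D \<subseteq> {a..b}"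
      "\<And>k. k \<in> D \<Longrightarrow> \<exists>s t. s < t \<and> k = {s..t} \<and> N * (t - s) \<le> \<bar>g t - g s\<bar>"
      "measure lebesgue S / 2 < (\<Sum>k\<in>D. measure lebesgue k)" by blast
    obtain q where q: "D \<subseteq> q" "q division_of {a..b}"
      using partial_division_extend_interval[OF D(2), of a b] D(3) by auto
    have Dk: "N * measure lebesgue k \<le> \<bar>g (Sup k) - g (Inf k)\<bar>" if "k \<in> D" for k
      using D(4)[OF that] by auto
    have "\<bar>V\<bar> + 1 < N * (\<Sum>k\<in>D. measure lebesgue k)"
      using N D(5) by (metis mult_less_cancel_left_pos)
    also have "\<dots> = (\<Sum>k\<in>D. N * measure lebesgue k)" by (simp add: sum_distrib_left)
    also have "\<dots> \<le> (\<Sum>k\<in>D. \<bar>g (Sup k) - g (Inf k)\<bar>)" by (rule sum_mono[OF Dk])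
    also have "\<dots> \<le> (\<Sum>k\<in>q. \<bar>g (Sup k) - g (Inf k)\<bar>)"
      using q by (intro sum_mono2) auto
    also have "\<dots> \<le> V" by (rule bv[OF q(2)])
    finally show False by linarith
  qed
  then show ?thesis using Sm by (simp add: negligible_iff_measure)
qed

text \<open>
  Absolute continuity bounds the variation over short intervals, which is all that is needed since
  being negligible is a local property.
\<close>
lemma locally_absolutely_continuous_local_variation:
  assumes "locally_absolutely_continuous g"
  obtains r where "0 < r"
    "\<And>d. d division_of {x - r..x + r} \<Longrightarrow> (\<Sum>k\<in>d. \<bar>g (Sup k) - g (Inf k)\<bar>) \<le> 1"
proof -
  obtain e where e: "0 < e"
    "\<And>(I::real set set) l u. finite I \<Longrightarrow> (\<And>i. i \<in> I \<Longrightarrow> x - 1 \<le> l i \<and> l i \<le> u i \<and> u i \<le> x + 1) \<Longrightarrow>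
       disjoint_family_on (\<lambda>i. {l i<..<u i}) I \<Longrightarrow> (\<Sum>i\<in>I. u i - l i) < e \<Longrightarrow>
       (\<Sum>i\<in>I. \<bar>g (u i) - g (l i)\<bar>) < 1"
    using absolutely_continuous_fun_on_indexed
        [OF assms[unfolded locally_absolutely_continuous_def, rule_format, of "x - 1" "x + 1"] zero_less_one]
    by blast
  define r where "r = min 1 (e / 3)"
  have r: "0 < r" "r \<le> 1" "2 * r < e" using e(1) by (auto simp: r_def min_def field_simps)
  have "(\<Sum>k\<in>d. \<bar>g (Sup k) - g (Inf k)\<bar>) \<le> 1" if d: "d division_of {x - r..x + r}" for d
  proof -
    note I = division_interval_real[OF d]
    have "disjoint_family_on (\<lambda>k. {Inf k<..<Sup k}) d"
      unfolding disjoint_family_on_def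
    proof (intro ballI impI)
      fix k k' assume k: "k \<in> d" "k' \<in> d" "k \<noteq> k'"
      have "interior k = {Inf k<..<Sup k}" "interior k' = {Inf k'<..<Sup k'}"
        using I(1)[OF k(1)] I(1)[OF k(2)] by (metis interior_atLeastAtMost_real)+
      then show "{Inf k<..<Sup k} \<inter> {Inf k'<..<Sup k'} = {}"
        using division_ofD(5)[OF d k] by simp
    qed
    moreover have "(\<Sum>k\<in>d. Sup k - Inf k) < e"
      using sum_increments_division[of "x - r" "x + r" d "\<lambda>x. x"] d r by simp
    ultimately have "(\<Sum>k\<in>d. \<bar>g (Sup k) - g (Inf k)\<bar>) < 1"
      using I(2-4) r d by (intro e(2)) force+
    then show ?thesis by simp
  qed
  with r(1) show thesis using that by blast
qed

lemma negligible_if_locally: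
  assumes "\<And>x::real. \<exists>r>0. negligible (S \<inter> ball x r)"
  shows "negligible S"
  unfolding locally_negligible_alt[of S]
proof
  fix x assume "x \<in> S"
  obtain r where "0 < r" "negligible (S \<inter> ball x r)" using assms by blast
  then show "\<exists>U. openin (top_of_set S) U \<and> x \<in> U \<and> negligible U"
    using \<open>x \<in> S\<close> by (intro exI[of _ "S \<inter> ball x r"]) (auto intro: openin_open_Int)
qed

text \<open>
  Lebesgue's differentiation theorem. Off the null sets where the difference quotients oscillate
  across a pair of rationals or are unbounded, they converge to a finite limit.
\<close>
lemma locally_absolutely_continuous_AE_differentiable:
  assumes f: "locally_absolutely_continuous f"
  shows "AE x in lborel. \<exists>D. (f has_real_derivative D) (at x)"
proof -
  have cont: "continuous_on UNIV f" by (rule locally_absolutely_continuous_imp_continuous[OF f])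
  define q where "q = (\<lambda>x h. (f (x + h) - f x) / h)"
  have opn: "open {x. \<exists>h. h \<noteq> 0 \<and> \<bar>h\<bar> < d \<and> r < \<phi> (q x h)}"
    if "continuous_on UNIV \<phi>" for d r :: real and \<phi> :: "real \<Rightarrow> real"
  proof -
    have "open {x. r < \<phi> (q x h)}" if "h \<noteq> 0" for h
      unfolding q_def
      by (intro open_Collect_less continuous_intros continuous_on_compose2[OF cont]
          continuous_on_compose2[OF \<open>continuous_on UNIV \<phi>\<close>]) (use that in auto)
    moreover have "{x. \<exists>h. h \<noteq> 0 \<and> \<bar>h\<bar> < d \<and> r < \<phi> (q x h)} = (\<Union>h\<in>{h. h \<noteq> 0 \<and> \<bar>h\<bar> < d}. {x. r < \<phi> (q x h)})"
      by auto
    ultimately show ?thesis by auto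
  qed
  \<comment> \<open>The points where the difference quotients, transformed by \<phi>, exceed r at all small scales. The
      transformations used are the identity, the negation and the absolute value.\<close>
  define large where "large = (\<lambda>\<phi> r. {x. \<forall>n::nat. \<exists>h. h \<noteq> 0 \<and> \<bar>h\<bar> < 1 / Suc n \<and> r < (\<phi> (q x h) :: real)})"
  have large_sets: "large \<phi> r \<in> sets borel" if "continuous_on UNIV \<phi>" for \<phi> r
  proof -
    have "large \<phi> r = (\<Inter>n::nat. {x. \<exists>h. h \<noteq> 0 \<and> \<bar>h\<bar> < 1 / Suc n \<and> r < \<phi> (q x h)})"
      by (auto simp: large_def)
    then show ?thesis using opn[OF that] by (auto intro!: sets.countable_INT'')
  qed
  have largeD: "\<exists>h. h \<noteq> 0 \<and> \<bar>h\<bar> < d \<and> r < \<phi> (q x h)" if xd: "x \<in> large \<phi> r" "0 < d" for x \<phi> r d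
  proof -
    obtain n where n: "1 / Suc n < d" using nat_approx_posE[OF xd(2)] by blast
    obtain h where "h \<noteq> 0" "\<bar>h\<bar> < 1 / Suc n" "r < \<phi> (q x h)" using xd(1) unfolding large_def by blast
    then show ?thesis using n by force
  qed
  have not_large: "eventually (\<lambda>h. \<phi> (q x h) \<le> r) (at 0)" if "x \<notin> large \<phi> r" for x \<phi> r
  proof -
    have "\<exists>n::nat. \<forall>h. h \<noteq> 0 \<longrightarrow> \<bar>h\<bar> < 1 / Suc n \<longrightarrow> \<not> r < \<phi> (q x h)"
      using that unfolding large_def by blast
    then obtain n :: nat where n: "\<And>h. h \<noteq> 0 \<Longrightarrow> \<bar>h\<bar> < 1 / Suc n \<Longrightarrow> \<phi> (q x h) \<le> r"
      by (meson not_less)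
    then show ?thesis unfolding eventually_at
      by (intro exI[of _ "1 / Suc n"]) (auto simp: dist_real_def)
  qed
  have quot: "\<exists>s t. s < t \<and> s \<le> x \<and> x \<le> t \<and> t - s = \<bar>h\<bar> \<and> f t - f s = q x h * (t - s)"
    if "h \<noteq> 0" for x h
  proof (cases "0 < h")
    case True
    then have "x < x + h" "x \<le> x" "x \<le> x + h" "x + h - x = \<bar>h\<bar>" "f (x + h) - f x = q x h * (x + h - x)"
      by (auto simp: q_def)
    then show ?thesis by blast
  next
    case False
    then have "x + h < x" "x + h \<le> x" "x \<le> x" "x - (x + h) = \<bar>h\<bar>" "f x - f (x + h) = q x h * (x - (x + h))"
      using that by (auto simp: q_def field_simps)
    then show ?thesis by blast
  qed
  have osc: "negligible (large (\<lambda>y. y) r \<inter> large uminus (- p))" if "p < r" for p r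
  proof (rule negligible_if_locally)
    fix z :: real
    \<comment> \<open>Subtracting the mean slope turns slopes below p and above r into slopes of opposite sign.\<close>
    define g where "g = (\<lambda>x. f x - (p + r) / 2 * x)"
    have g: "locally_absolutely_continuous g"
      unfolding locally_absolutely_continuous_def
    proof (intro allI)
      fix a b
      show "absolutely_continuous_fun_on a b g"
      proof (rule absolutely_continuous_fun_on_dominated[OF _ absolutely_continuous_fun_on_ident,
            where L = "1 + \<bar>(p + r) / 2\<bar>"])
        show "absolutely_continuous_fun_on a b f" using f by (simp add: locally_absolutely_continuous_def)
        fix s t
        have "\<bar>g t - g s\<bar> \<le> \<bar>f t - f s\<bar> + \<bar>(p + r) / 2 * (t - s)\<bar>"
          unfolding g_def right_diff_distrib by linarith
        also have "\<dots> \<le> (1 + \<bar>(p + r) / 2\<bar>) * (\<bar>f t - f s\<bar> + \<bar>t - s\<bar>)"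
          unfolding abs_mult by (simp add: algebra_simps)
        finally show "\<bar>g t - g s\<bar> \<le> (1 + \<bar>(p + r) / 2\<bar>) * (\<bar>f t - f s\<bar> + \<bar>t - s\<bar>)" .
      qed
    qed
    obtain \<rho> where \<rho>: "0 < \<rho>"
      "\<And>d. d division_of {z - \<rho>..z + \<rho>} \<Longrightarrow> (\<Sum>k\<in>d. \<bar>g (Sup k) - g (Inf k)\<bar>) \<le> 1"
      using locally_absolutely_continuous_local_variation[OF g] by blast
    let ?S = "large (\<lambda>y. y) r \<inter> large uminus (- p) \<inter> ball z \<rho>"
    have "negligible ?S"
    proof (rule negligible_oscillation_set[of "z - \<rho>" "z + \<rho>" "(r - p) / 2" g 1])
      show "?S \<in> sets lebesgue"
        using large_sets[of "\<lambda>y. y" r] large_sets[of uminus "- p"] by (auto simp: continuous_on_minus continuous_on_id)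
      show "?S \<subseteq> {z - \<rho><..<z + \<rho>}" by (auto simp: dist_real_def abs_less_iff)
      fix x d :: real assume x: "x \<in> ?S" and d: "0 < d"
      obtain h where h: "h \<noteq> 0" "\<bar>h\<bar> < d" "r < q x h" using largeD[of x "\<lambda>y. y" r d] x d by auto
      obtain s t where st: "s < t" "s \<le> x" "x \<le> t" "t - s = \<bar>h\<bar>" "f t - f s = q x h * (t - s)"
        using quot[OF h(1)] by blast
      have "t - s < d" using st(4) h(2) by simp
      have "r * (t - s) \<le> f t - f s" using st h by simp
      then have "(r - p) / 2 * (t - s) \<le> g t - g s" by (simp add: g_def field_simps)
      then show "\<exists>s t. s < t \<and> s \<le> x \<and> x \<le> t \<and> t - s < d \<and> (r - p) / 2 * (t - s) \<le> g t - g s"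
        using st(1-3) \<open>t - s < d\<close> by blast
      obtain h where h: "h \<noteq> 0" "\<bar>h\<bar> < d" "q x h < p" using largeD[of x uminus "- p" d] x d by auto
      obtain s t where st: "s < t" "s \<le> x" "x \<le> t" "t - s = \<bar>h\<bar>" "f t - f s = q x h * (t - s)"
        using quot[OF h(1)] by blast
      have "t - s < d" using st(4) h(2) by simp
      have "f t - f s \<le> p * (t - s)" using st h by simp
      then have "g t - g s \<le> - ((r - p) / 2) * (t - s)" by (simp add: g_def field_simps)
      then show "\<exists>s t. s < t \<and> s \<le> x \<and> x \<le> t \<and> t - s < d \<and> g t - g s \<le> - ((r - p) / 2) * (t - s)"
        using st(1-3) \<open>t - s < d\<close> by blast
    qed (use \<rho> that in auto)
    then show "\<exists>\<rho>>0. negligible (large (\<lambda>y. y) r \<inter> large uminus (- p) \<inter> ball z \<rho>)"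
      using \<rho>(1) by blast
  qed
  have unb: "negligible (\<Inter>N::nat. large abs (real N))"
  proof (rule negligible_if_locally)
    fix z :: real
    obtain \<rho> where \<rho>: "0 < \<rho>"
      "\<And>d. d division_of {z - \<rho>..z + \<rho>} \<Longrightarrow> (\<Sum>k\<in>d. \<bar>f (Sup k) - f (Inf k)\<bar>) \<le> 1"
      using locally_absolutely_continuous_local_variation[OF f] by blast
    let ?S = "(\<Inter>N::nat. large abs (real N)) \<inter> ball z \<rho>"
    have "negligible ?S"
    proof (rule negligible_infinite_slope_set[OF \<rho>(2)])
      have "large abs r \<in> sets borel" for r
        by (rule large_sets) (intro continuous_intros)
      then have "(\<Inter>N::nat. large abs (real N)) \<in> sets borel"
        by (intro sets.countable_INT'') auto
      then show "?S \<in> sets lebesgue" by auto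
      show "?S \<subseteq> {z - \<rho><..<z + \<rho>}" by (auto simp: dist_real_def abs_less_iff)
      fix x d N :: real assume x: "x \<in> ?S" and d: "0 < d"
      obtain n :: nat where n: "N \<le> n" using real_arch_simple by blast
      obtain h where h: "h \<noteq> 0" "\<bar>h\<bar> < d" "n < \<bar>q x h\<bar>" using largeD[of x abs "real n" d] x d by auto
      obtain s t where st: "s < t" "s \<le> x" "x \<le> t" "t - s = \<bar>h\<bar>" "f t - f s = q x h * (t - s)"
        using quot[OF h(1)] by blast
      have "t - s < d" using st(4) h(2) by simp
      have "N * (t - s) \<le> \<bar>q x h\<bar> * (t - s)" using st h n by (intro mult_right_mono) auto
      also have "\<dots> = \<bar>f t - f s\<bar>" using st by (simp add: abs_mult)
      finally show "\<exists>s t. s < t \<and> s \<le> x \<and> x \<le> t \<and> t - s < d \<and> N * (t - s) \<le> \<bar>f t - f s\<bar>"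
        using st(1-3) \<open>t - s < d\<close> by blast
    qed
    then show "\<exists>\<rho>>0. negligible ((\<Inter>N::nat. large abs (real N)) \<inter> ball z \<rho>)" using \<rho>(1) by blast
  qed
  define R :: "(real \<times> real) set" where "R = {(p, r). p \<in> \<rat> \<and> r \<in> \<rat> \<and> p < r}"
  have "countable R"
    by (rule countable_subset[of _ "\<rat> \<times> \<rat>"]) (auto simp: R_def countable_rat)
  define X where "X = (\<lambda>(p, r). large (\<lambda>y. y) r \<inter> large uminus (- p))"
  define B where "B = (\<Union>i\<in>R. X i) \<union> (\<Inter>N::nat. large abs (real N))"
  have B: "B \<in> sets borel" "negligible B"
  proof -
    have "large (\<lambda>y. y) r \<in> sets borel" "large uminus r \<in> sets borel" for r
      by (rule large_sets, intro continuous_intros)+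
    then have "X i \<in> sets borel" for i
      by (cases i) (auto simp: X_def)
    moreover have "large abs r \<in> sets borel" for r
      by (rule large_sets) (intro continuous_intros)
    ultimately show "B \<in> sets borel"
      unfolding B_def using \<open>countable R\<close>
      by (intro sets.Un sets.countable_UN' sets.countable_INT'') auto
    have "negligible (X i)" if "i \<in> R" for i
      using osc that by (auto simp: X_def R_def)
    then have "negligible (\<Union>i\<in>R. X i)"
      using \<open>countable R\<close> by (intro negligible_countable_Union) auto
    then show "negligible B" unfolding B_def using unb by (rule negligible_Un)
  qed
  have "\<exists>D. (f has_real_derivative D) (at x)" if "x \<notin> B" for x
  proof -
    let ?Q = "\<lambda>h. ereal (q x h)"
    have nt: "at (0::real) \<noteq> bot" by simp
    obtain N :: nat where "x \<notin> large abs (real N)" using \<open>x \<notin> B\<close> by (auto simp: B_def)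
    then have bd: "eventually (\<lambda>h. \<bar>q x h\<bar> \<le> N) (at 0)" by (rule not_large)
    have "Limsup (at 0) ?Q \<le> ereal N"
      by (rule Limsup_bounded[OF eventually_mono[OF bd]]) auto
    have "ereal (- real N) \<le> Liminf (at 0) ?Q"
      by (rule Liminf_bounded[OF eventually_mono[OF bd]]) auto
    have "Limsup (at 0) ?Q \<le> Liminf (at 0) ?Q"
    proof (rule ccontr)
      assume "\<not> ?thesis"
      then have "Liminf (at 0) ?Q < Limsup (at 0) ?Q" by simp
      then obtain a where a: "Liminf (at 0) ?Q < ereal a" "ereal a < Limsup (at 0) ?Q"
        using ereal_dense2 by blast
      obtain b where b: "ereal a < ereal b" "ereal b < Limsup (at 0) ?Q"
        using ereal_dense2[OF a(2)] by blast
      have "a < (a + b) / 2" "(a + b) / 2 < b" using b(1) by auto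
      then obtain p r where pr: "p \<in> \<rat>" "a < p" "p < (a+b)/2" "r \<in> \<rat>" "(a+b)/2 < r" "r < b"
        using Rats_dense_in_real by metis
      have "x \<in> large (\<lambda>y. y) r"
      proof (rule ccontr)
        assume "x \<notin> large (\<lambda>y. y) r"
        from not_large[OF this] have "Limsup (at 0) ?Q \<le> ereal r"
          by (intro Limsup_bounded) simp
        then show False using b(2) pr(6) by (meson ereal_less_eq(3) less_le_not_le order_trans not_less order_less_le_trans less_ereal.simps(1))
      qed
      moreover have "x \<in> large uminus (- p)"
      proof (rule ccontr)
        assume "x \<notin> large uminus (- p)"
        from not_large[OF this] have "ereal p \<le> Liminf (at 0) ?Q"
          by (intro Liminf_bounded) simp
        then show False using a(1) pr(2) by (meson less_ereal.simps(1) less_trans not_less)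
      qed
      ultimately show False using \<open>x \<notin> B\<close> pr unfolding B_def R_def X_def by fastforce
    qed
    then have eq: "Liminf (at 0) ?Q = Limsup (at 0) ?Q"
      using Liminf_le_Limsup[OF nt, of ?Q] by order
    then obtain D where "Limsup (at 0) ?Q = ereal D"
      using \<open>Limsup (at 0) ?Q \<le> ereal N\<close> \<open>ereal (- real N) \<le> Liminf (at 0) ?Q\<close>
      by (cases "Limsup (at 0) ?Q") auto
    then have "(?Q \<longlongrightarrow> ereal D) (at 0)"
      using eq tendsto_iff_Liminf_eq_Limsup[OF nt, of ?Q "ereal D"] by simp
    then have "(q x \<longlongrightarrow> D) (at 0)" by simp
    then show ?thesis unfolding DERIV_def q_def by blast
  qed
  moreover have "B \<in> null_sets lborel"
    using B null_sets_completion_iff[of B lborel] by (simp add: negligible_iff_null_sets)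
  ultimately show ?thesis by (intro AE_I'[of B]) auto
qed

section \<open>Functions with a derivative almost everywhere\<close>

text \<open>
  The derivative is an explicit Borel function, determined only almost everywhere, since the value of
  \<open>deriv f\<close> says nothing at points where f is not differentiable.
\<close>
definition ac_derivative :: "(real \<Rightarrow> real) \<Rightarrow> (real \<Rightarrow> real) \<Rightarrow> bool" where
  "ac_derivative f f' \<longleftrightarrow> locally_absolutely_continuous f \<and> f' \<in> borel_measurable borel \<and>
     (AE x in lborel. (f has_real_derivative f' x) (at x))"

lemma ac_derivative_continuous: "ac_derivative f f' \<Longrightarrow> continuous_on UNIV f"
  unfolding ac_derivative_def using locally_absolutely_continuous_imp_continuous by blast

lemma ac_derivative_measurable: "ac_derivative f f' \<Longrightarrow> f' \<in> borel_measurable borel"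
  unfolding ac_derivative_def by blast

lemma ac_derivative_has_integral:
  assumes "ac_derivative f f'" "a \<le> b"
  shows "(f' has_integral f b - f a) {a..b}"
  using assms absolutely_continuous_has_integral
  unfolding ac_derivative_def locally_absolutely_continuous_def by blast

text \<open>
  A Borel version of the derivative is the limit of the difference quotients with step 1 / n.
\<close>
lemma locally_absolutely_continuous_imp_ac_derivative:
  assumes f: "locally_absolutely_continuous f"
  obtains f' where "ac_derivative f f'" "AE x in lborel. deriv f x = f' x"
proof -
  define f' where "f' = (\<lambda>x. lim (\<lambda>n. (f (x + 1 / Suc n) - f x) / (1 / Suc n)))"
  have cont: "continuous_on UNIV f" by (rule locally_absolutely_continuous_imp_continuous[OF f])
  have meas: "f' \<in> borel_measurable borel"
    unfolding f'_def
    by (intro borel_measurable_lim_metric borel_measurable_continuous_onI continuous_intros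
        continuous_on_compose2[OF cont]) auto
  have eq: "f' x = D" if "(f has_real_derivative D) (at x)" for x D
  proof -
    have "((\<lambda>h. (f (x + h) - f x) / h) \<longlongrightarrow> D) (at 0)" using that by (simp add: DERIV_def)
    moreover have "filterlim (\<lambda>n. 1 / real (Suc n)) (at 0) sequentially"
      using LIMSEQ_Suc[OF lim_1_over_n[where 'a=real]]
      by (auto simp: filterlim_at eventually_sequentially)
    ultimately have "(\<lambda>n. (f (x + 1 / Suc n) - f x) / (1 / Suc n)) \<longlonglongrightarrow> D"
      by (rule filterlim_compose)
    then show ?thesis unfolding f'_def by (rule limI)
  qed
  have AE: "AE x in lborel. (f has_real_derivative f' x) (at x)"
    using locally_absolutely_continuous_AE_differentiable[OF f] by eventually_elim (use eq in auto)
  show thesis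
  proof (rule that)
    show "ac_derivative f f'" using f meas AE by (simp add: ac_derivative_def)
    show "AE x in lborel. deriv f x = f' x" using AE by eventually_elim (rule DERIV_imp_deriv)
  qed
qed

lemma ac_derivative_ident: "ac_derivative (\<lambda>x. x) (\<lambda>_. 1)"
  by (auto simp: ac_derivative_def locally_absolutely_continuous_def absolutely_continuous_fun_on_ident)

lemma ac_derivative_mult:
  assumes f: "ac_derivative f f'" and g: "ac_derivative g g'"
  shows "ac_derivative (\<lambda>x. f x * g x) (\<lambda>x. f' x * g x + f x * g' x)"
proof -
  note cont = ac_derivative_continuous[OF f] ac_derivative_continuous[OF g]
  have "absolutely_continuous_fun_on a b (\<lambda>x. f x * g x)" for a b
  proof -
    have "bounded (f ` {a..b})" "bounded (g ` {a..b})"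
      using cont by (auto intro!: compact_imp_bounded compact_continuous_image elim: continuous_on_subset)
    then obtain A B where AB: "\<And>x. x \<in> {a..b} \<Longrightarrow> \<bar>f x\<bar> \<le> A" "\<And>x. x \<in> {a..b} \<Longrightarrow> \<bar>g x\<bar> \<le> B"
      unfolding bounded_iff by (metis imageI real_norm_def)
    show ?thesis
    proof (rule absolutely_continuous_fun_on_dominated[of a b f g _ "max A B"])
      fix s t assume st: "s \<in> {a..b}" "t \<in> {a..b}"
      have "f t * g t - f s * g s = (f t - f s) * g t + f s * (g t - g s)" by (simp add: algebra_simps)
      also have "\<bar>\<dots>\<bar> \<le> \<bar>f t - f s\<bar> * \<bar>g t\<bar> + \<bar>f s\<bar> * \<bar>g t - g s\<bar>"
        using abs_triangle_ineq[of "(f t - f s) * g t" "f s * (g t - g s)"] by (simp add: abs_mult)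
      also have "\<dots> \<le> \<bar>f t - f s\<bar> * max A B + max A B * \<bar>g t - g s\<bar>"
        using AB st by (intro add_mono mult_mono) (auto simp: le_max_iff_disj intro: order_trans[OF abs_ge_zero])
      finally show "\<bar>f t * g t - f s * g s\<bar> \<le> max A B * (\<bar>f t - f s\<bar> + \<bar>g t - g s\<bar>)"
        by (simp add: algebra_simps)
    qed (use f g in \<open>auto simp: ac_derivative_def locally_absolutely_continuous_def\<close>)
  qed
  moreover have "(\<lambda>x. f' x * g x + f x * g' x) \<in> borel_measurable borel"
    using cont[THEN borel_measurable_continuous_onI] f g
    by (auto simp: ac_derivative_def)
  moreover have "AE x in lborel. ((\<lambda>x. f x * g x) has_real_derivative f' x * g x + f x * g' x) (at x)"
  proof -
    have "AE x in lborel. (f has_real_derivative f' x) (at x)"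
      "AE x in lborel. (g has_real_derivative g' x) (at x)"
      using f g by (auto simp: ac_derivative_def)
    then show ?thesis
      by eventually_elim (auto intro!: derivative_eq_intros)
  qed
  ultimately show ?thesis by (simp add: ac_derivative_def locally_absolutely_continuous_def)
qed

lemma ac_derivative_compose:
  assumes f: "ac_derivative f f'" and fS: "\<And>x. f x \<in> S"
    and \<psi>: "\<And>y. y \<in> S \<Longrightarrow> (\<psi> has_real_derivative \<psi>' y) (at y)" "continuous_on S \<psi>'"
  shows "ac_derivative (\<lambda>x. \<psi> (f x)) (\<lambda>x. \<psi>' (f x) * f' x)"
proof -
  note cont = ac_derivative_continuous[OF f]
  have "absolutely_continuous_fun_on a b (\<lambda>x. \<psi> (f x))" for a b
  proof -
    have cab: "continuous_on {a..b} f" using cont continuous_on_subset by blast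
    have "compact (f ` {a..b})" using cab by (intro compact_continuous_image) auto
    then have "bounded (\<psi>' ` f ` {a..b})"
      by (intro compact_imp_bounded compact_continuous_image[of "f ` {a..b}"] continuous_on_subset[OF \<psi>(2)])
        (use fS in auto)
    then obtain L where L: "\<And>x. x \<in> {a..b} \<Longrightarrow> \<bar>\<psi>' (f x)\<bar> \<le> L"
      unfolding bounded_iff by (metis imageI real_norm_def)
    have conv: "convex (f ` {a..b})"
      using connected_continuous_image[OF cab] by (simp add: connected_convex_1)
    show ?thesis
    proof (rule absolutely_continuous_fun_on_dominated[of a b f f _ "\<bar>L\<bar>"])
      fix s t assume st: "s \<in> {a..b}" "t \<in> {a..b}"
      have "norm (\<psi> (f t) - \<psi> (f s)) \<le> L * norm (f t - f s)"
      proof (rule field_differentiable_bound[OF conv])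
        show "(\<psi> has_field_derivative \<psi>' z) (at z within f ` {a..b})" if "z \<in> f ` {a..b}" for z
          using that fS \<psi>(1) by (metis has_field_derivative_at_within imageE)
        show "norm (\<psi>' z) \<le> L" if "z \<in> f ` {a..b}" for z using that L by auto
      qed (use st in auto)
      also have "\<dots> \<le> \<bar>L\<bar> * norm (f t - f s)" by (intro mult_right_mono) auto
      also have "\<dots> \<le> \<bar>L\<bar> * (\<bar>f t - f s\<bar> + \<bar>f t - f s\<bar>)" by (intro mult_left_mono) auto
      finally show "\<bar>\<psi> (f t) - \<psi> (f s)\<bar> \<le> \<bar>L\<bar> * (\<bar>f t - f s\<bar> + \<bar>f t - f s\<bar>)" by simp
    qed (use f in \<open>auto simp: ac_derivative_def locally_absolutely_continuous_def\<close>)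
  qed
  moreover have "(\<lambda>x. \<psi>' (f x) * f' x) \<in> borel_measurable borel"
  proof -
    have "continuous_on UNIV (\<lambda>x. \<psi>' (f x))"
      by (rule continuous_on_compose2[OF \<psi>(2) cont]) (use fS in auto)
    then show ?thesis
      using borel_measurable_continuous_onI ac_derivative_measurable[OF f] by (intro borel_measurable_times) auto
  qed
  moreover have "AE x in lborel. ((\<lambda>x. \<psi> (f x)) has_real_derivative \<psi>' (f x) * f' x) (at x)"
  proof -
    have "AE x in lborel. (f has_real_derivative f' x) (at x)" using f by (auto simp: ac_derivative_def)
    then show ?thesis
      by eventually_elim (intro DERIV_chain2[where f = \<psi> and g = f] \<psi>(1) fS)
  qed
  ultimately show ?thesis by (simp add: ac_derivative_def locally_absolutely_continuous_def)
qed

lemma ac_derivative_C1: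
  assumes "\<And>x. (\<psi> has_real_derivative \<psi>' x) (at x)" "continuous_on UNIV \<psi>'"
  shows "ac_derivative \<psi> \<psi>'"
  using ac_derivative_compose[OF ac_derivative_ident, of UNIV \<psi> \<psi>'] assms by simp

section \<open>The potential and its Legendre transform\<close>

text \<open>
  Even convex potentials that grow at least like the power 1 + \<epsilon> and at most like the power 2 - \<epsilon>,
  expressed through the logarithmic derivative.
\<close>
locale intermediate_growth =
  fixes \<Phi> \<Phi>' \<Phi>'' :: "real \<Rightarrow> real" and M \<epsilon> :: real
  assumes even: "\<And>x. \<Phi> (- x) = \<Phi> x"
    and convex: "convex_on UNIV \<Phi>"
    and deriv1: "\<And>x. (\<Phi> has_real_derivative \<Phi>' x) (at x)"
    and deriv2: "\<And>x. (\<Phi>' has_real_derivative \<Phi>'' x) (at x)"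
    and M: "M > 0" "\<Phi> M > 0"
    and eps: "0 < \<epsilon>" "\<epsilon> \<le> 1/2"
    and growth: "\<And>x. x \<ge> M \<Longrightarrow>
          (1 + \<epsilon>) * \<Phi> x \<le> x * \<Phi>' x \<and> x * \<Phi>' x \<le> (2 - \<epsilon>) * \<Phi> x"
begin

lemma continuous_\<Phi>: "continuous_on UNIV \<Phi>"
  using DERIV_isCont[OF deriv1] by (simp add: continuous_at_imp_continuous_on)

lemma continuous_\<Phi>': "continuous_on UNIV \<Phi>'"
  using DERIV_isCont[OF deriv2] by (simp add: continuous_at_imp_continuous_on)

lemma even_abs: "\<Phi> \<bar>x\<bar> = \<Phi> x"
  by (cases "0 \<le> x") (simp_all add: even)

lemma \<Phi>'_odd: "\<Phi>' (- x) = - \<Phi>' x"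
proof -
  have "((\<lambda>y. \<Phi> (- y)) has_real_derivative \<Phi>' (- x) * (- 1)) (at x)"
    by (rule DERIV_chain2[OF deriv1]) (auto intro!: derivative_eq_intros)
  then have "(\<Phi> has_real_derivative - \<Phi>' (- x)) (at x)" by (simp add: even)
  then show ?thesis using DERIV_unique[OF deriv1[of x]] by simp
qed

lemma above_tangent: "\<Phi> x + \<Phi>' x * (y - x) \<le> \<Phi> y"
  using convex_on_imp_above_tangent[OF convex, of x y "\<Phi>' x"] deriv1[of x] by simp

lemma \<Phi>'_mono: "x \<le> y \<Longrightarrow> \<Phi>' x \<le> \<Phi>' y"
proof (cases "x = y")
  case False
  assume "x \<le> y"
  have "\<Phi>' x * (y - x) \<le> \<Phi>' y * (y - x)"
    using above_tangent[of x y] above_tangent[of y x] by (simp add: algebra_simps)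
  then show ?thesis using \<open>x \<le> y\<close> False by simp
qed simp

lemma \<Phi>'_nonneg: "0 \<le> x \<Longrightarrow> 0 \<le> \<Phi>' x"
proof -
  have "\<Phi>' 0 = - \<Phi>' 0" using \<Phi>'_odd[of 0] by (simp only: minus_zero)
  then show "0 \<le> x \<Longrightarrow> 0 \<le> \<Phi>' x" using \<Phi>'_mono[of 0 x] by linarith
qed

lemma \<Phi>'_abs: "x * \<Phi>' x = \<bar>x\<bar> * \<Phi>' \<bar>x\<bar>"
  by (cases "0 \<le> x") (simp_all add: \<Phi>'_odd)

lemma xd\<Phi>_nonneg: "0 \<le> x * \<Phi>' x"
  by (subst \<Phi>'_abs) (intro mult_nonneg_nonneg \<Phi>'_nonneg abs_ge_zero)

lemma \<Phi>_mono: "0 \<le> x \<Longrightarrow> x \<le> y \<Longrightarrow> \<Phi> x \<le> \<Phi> y"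
proof (rule DERIV_nonneg_imp_nondecreasing[of x y \<Phi>])
  fix z assume "0 \<le> x" "x \<le> z"
  then show "\<exists>d. (\<Phi> has_real_derivative d) (at z) \<and> 0 \<le> d"
    using deriv1[of z] \<Phi>'_nonneg[of z] by (intro exI[of _ "\<Phi>' z"]) simp
qed

lemma \<Phi>_pos: "M \<le> x \<Longrightarrow> 0 < \<Phi> x"
  using \<Phi>_mono[of M x] M by simp

lemma \<Phi>'_M_pos: "0 < \<Phi>' M"
proof -
  have "0 < (1 + \<epsilon>) * \<Phi> M" using eps M by simp
  then have "0 < M * \<Phi>' M" using growth[of M] by linarith
  then show ?thesis using M by (simp add: zero_less_mult_iff)
qed

lemma \<Phi>_le_xd\<Phi>: "\<Phi> x \<le> x * \<Phi>' x + \<Phi> M"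
proof (cases "\<bar>x\<bar> \<le> M")
  case True
  then have "\<Phi> \<bar>x\<bar> \<le> \<Phi> M" by (intro \<Phi>_mono) auto
  then show ?thesis using xd\<Phi>_nonneg[of x] by (simp add: even_abs)
next
  case False
  then have "0 < \<Phi> \<bar>x\<bar>" "(1 + \<epsilon>) * \<Phi> \<bar>x\<bar> \<le> \<bar>x\<bar> * \<Phi>' \<bar>x\<bar>"
    using growth[of "\<bar>x\<bar>"] \<Phi>_pos[of "\<bar>x\<bar>"] by auto
  moreover have "0 \<le> \<epsilon> * \<Phi> \<bar>x\<bar>" using calculation(1) eps by simp
  ultimately show ?thesis
    using M unfolding \<Phi>'_abs[symmetric] even_abs by (simp add: algebra_simps)
qed

text \<open>
  Outside of [-1, 1] the factor x only helps, and inside monotonicity of \<Phi>' suffices.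
\<close>
lemma abs_\<Phi>'_le: "\<bar>\<Phi>' x\<bar> \<le> x * \<Phi>' x + \<Phi>' 1"
proof -
  have eq: "\<bar>\<Phi>' x\<bar> = \<Phi>' \<bar>x\<bar>"
  proof (cases "0 \<le> x")
    case True
    then show ?thesis using \<Phi>'_nonneg[of x] by simp
  next
    case False
    then show ?thesis using \<Phi>'_nonneg[of "- x"] \<Phi>'_odd[of x] by simp
  qed
  have n1: "0 \<le> \<Phi>' 1" "0 \<le> \<Phi>' \<bar>x\<bar>" using \<Phi>'_nonneg by auto
  show ?thesis
  proof (cases "\<bar>x\<bar> \<le> 1")
    case True
    then show ?thesis using \<Phi>'_mono[of "\<bar>x\<bar>" 1] xd\<Phi>_nonneg[of x] eq by simp
  next
    case False
    then have "1 * \<Phi>' \<bar>x\<bar> \<le> \<bar>x\<bar> * \<Phi>' \<bar>x\<bar>" using n1 by (intro mult_right_mono) auto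
    then show ?thesis using n1 eq \<Phi>'_abs[of x] by simp
  qed
qed

text \<open>
  By the lower growth condition, the quotient of the potential by x to the power 1 + \<epsilon> increases
  beyond M.
\<close>
lemma \<Phi>_contract:
  assumes "M \<le> l * x" "0 < l" "l \<le> 1"
  shows "\<Phi> (l * x) \<le> l powr (1 + \<epsilon>) * \<Phi> x"
proof -
  have lx: "0 < l * x" using assms(1) M(1) by linarith
  then have x: "0 < x" using assms(2) by (simp add: zero_less_mult_iff)
  have le: "l * x \<le> x" using assms(3) x mult_right_mono[of l 1 x] by simp
  let ?h = "\<lambda>y. ln (\<Phi> y) - (1 + \<epsilon>) * ln y"
  have "?h (l * x) \<le> ?h x"
  proof (rule DERIV_nonneg_imp_nondecreasing[of "l * x" x ?h, OF le])
    fix y assume "l * x \<le> y"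
    then have y: "M \<le> y" "0 < y" "0 < \<Phi> y"
      using assms(1) M(1) \<Phi>_pos[of y] by linarith+
    have "(?h has_real_derivative (1 / \<Phi> y * \<Phi>' y - (1 + \<epsilon>) * (1 / y))) (at y)"
      using y deriv1 by (intro DERIV_chain2[OF DERIV_ln_divide] DERIV_cmult DERIV_ln_divide DERIV_diff) auto
    moreover have "0 \<le> 1 / \<Phi> y * \<Phi>' y - (1 + \<epsilon>) * (1 / y)"
    proof -
      have "(1 + \<epsilon>) * \<Phi> y / (\<Phi> y * y) \<le> y * \<Phi>' y / (\<Phi> y * y)"
        using growth[OF y(1)] y by (intro divide_right_mono) auto
      then show ?thesis using y by simp
    qed
    ultimately show "\<exists>d. (?h has_real_derivative d) (at y) \<and> 0 \<le> d" by blast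
  qed
  then have "ln (\<Phi> (l * x)) \<le> (1 + \<epsilon>) * ln l + ln (\<Phi> x)"
    using x assms(2) by (simp add: ln_mult algebra_simps)
  then have "exp (ln (\<Phi> (l * x))) \<le> exp ((1 + \<epsilon>) * ln l) * exp (ln (\<Phi> x))"
    unfolding exp_add[symmetric] by simp
  moreover have "0 < \<Phi> (l * x)" "0 < \<Phi> x" using assms(1) le by (auto intro: \<Phi>_pos)
  ultimately show ?thesis using assms(2) by (simp add: powr_def)
qed

text \<open>
  By the upper growth condition, the quotient of the potential by the square of x decreases beyond M.
\<close>
lemma \<Phi>_le_square: "\<Phi> x \<le> \<Phi> M / M\<^sup>2 * x\<^sup>2" if "M \<le> x"
proof -
  let ?h = "\<lambda>y. \<Phi> y / y\<^sup>2"
  have "?h x \<le> ?h M"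
  proof (rule DERIV_nonpos_imp_nonincreasing[of M x ?h, OF that])
    fix y assume y: "M \<le> y" "y \<le> x"
    then have "0 < y" using M by simp
    have "(?h has_real_derivative (\<Phi>' y * y\<^sup>2 - \<Phi> y * (2 * y)) / (y\<^sup>2 * y\<^sup>2)) (at y)"
      using \<open>0 < y\<close> by (auto intro!: derivative_eq_intros deriv1 simp: power2_eq_square)
    moreover have "\<Phi>' y * y\<^sup>2 - \<Phi> y * (2 * y) \<le> 0"
    proof -
      have "0 \<le> \<epsilon> * \<Phi> y" using eps \<Phi>_pos[OF y(1)] by simp
      then have "y * \<Phi>' y - 2 * \<Phi> y \<le> 0" using growth[OF y(1)] by (simp add: algebra_simps)
      then have "y * (y * \<Phi>' y - 2 * \<Phi> y) \<le> 0" using \<open>0 < y\<close> by (intro mult_nonneg_nonpos) auto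
      then show ?thesis by (simp add: power2_eq_square algebra_simps)
    qed
    then have "(\<Phi>' y * y\<^sup>2 - \<Phi> y * (2 * y)) / (y\<^sup>2 * y\<^sup>2) \<le> 0"
      by (intro divide_nonpos_nonneg) auto
    ultimately show "\<exists>d. (?h has_real_derivative d) (at y) \<and> d \<le> 0" by blast
  qed
  then show ?thesis using M that by (simp add: field_simps)
qed

text \<open>
  The Legendre transform as a real function; it is finite because the potential grows faster than
  linearly.
\<close>
definition Lf :: "real \<Rightarrow> real" where "Lf y = (SUP x. x * y - \<Phi> x)"

lemma bdd_above_legendre: "bdd_above (range (\<lambda>x. x * y - \<Phi> x))"
proof -
  \<comment> \<open>Beyond X the lower growth bound makes the potential exceed the linear function with slope y.\<close>
  define X where "X = max M (M * (M * \<bar>y\<bar> / \<Phi> M) powr (1 / \<epsilon>))"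
  have X: "M \<le> X" "0 < X" using M by (auto simp: X_def)
  have "x * y - \<Phi> x \<le> X * \<bar>y\<bar> + \<bar>\<Phi> 0\<bar>" for x
  proof -
    have le: "x * y \<le> \<bar>x\<bar> * \<bar>y\<bar>" by (simp add: abs_mult[symmetric])
    have ge: "\<Phi> 0 \<le> \<Phi> \<bar>x\<bar>" by (intro \<Phi>_mono) auto
    show ?thesis
    proof (cases "\<bar>x\<bar> \<le> X")
      case True
      then have "\<bar>x\<bar> * \<bar>y\<bar> \<le> X * \<bar>y\<bar>" by (intro mult_right_mono) auto
      then show ?thesis using le ge by (simp add: even_abs)
    next
      case False
      define l where "l = M / \<bar>x\<bar>"
      have l: "0 < l" "l \<le> 1" "l * \<bar>x\<bar> = M" using False X M by (auto simp: l_def field_simps)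
      have "(M * \<bar>y\<bar> / \<Phi> M) powr (1 / \<epsilon>) \<le> \<bar>x\<bar> / M"
        using False M by (simp add: X_def field_simps)
      then have "((M * \<bar>y\<bar> / \<Phi> M) powr (1 / \<epsilon>)) powr \<epsilon> \<le> (\<bar>x\<bar> / M) powr \<epsilon>"
        using eps by (intro powr_mono2) auto
      then have "M * \<bar>y\<bar> / \<Phi> M \<le> (1 / l) powr \<epsilon>"
        using eps M by (simp add: powr_powr l_def)
      then have "M * \<bar>y\<bar> * l powr \<epsilon> \<le> \<Phi> M"
        using l M by (simp add: powr_divide field_simps)
      also have "\<Phi> M \<le> l powr (1 + \<epsilon>) * \<Phi> \<bar>x\<bar>"
        using \<Phi>_contract[of l "\<bar>x\<bar>"] l by simp
      finally have "M * \<bar>y\<bar> * l powr \<epsilon> \<le> (l * \<Phi> \<bar>x\<bar>) * l powr \<epsilon>"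
        using l by (simp add: powr_add algebra_simps)
      then have "M * \<bar>y\<bar> \<le> l * \<Phi> \<bar>x\<bar>" using l by simp
      then have "\<bar>x\<bar> * \<bar>y\<bar> \<le> \<Phi> \<bar>x\<bar>"
        using False X M by (simp add: l_def field_simps)
      moreover have "0 \<le> X * \<bar>y\<bar> + \<bar>\<Phi> 0\<bar>" using X by simp
      ultimately show ?thesis using le by (simp add: even_abs)
    qed
  qed
  then show ?thesis by (intro bdd_aboveI[of _ "X * \<bar>y\<bar> + \<bar>\<Phi> 0\<bar>"]) auto
qed

lemma legendre_fenchel_eq: "legendre_fenchel \<Phi> y = ereal (Lf y)"
proof -
  obtain b where b: "\<And>x. x * y - \<Phi> x \<le> b" using bdd_above_legendre[of y] by (auto simp: bdd_above_def)
  have "(SUP x. ereal (x * y - \<Phi> x)) \<le> ereal b" using b by (intro SUP_least) auto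
  moreover have "ereal (0 * y - \<Phi> 0) \<le> (SUP x. ereal (x * y - \<Phi> x))" by (rule SUP_upper) simp
  ultimately have "\<bar>SUP x. ereal (x * y - \<Phi> x)\<bar> \<noteq> \<infinity>" by auto
  from ereal_SUP[OF this] show ?thesis
    by (simp add: legendre_fenchel_def Lf_def mult.commute)
qed

lemma young: "x * y \<le> \<Phi> x + Lf y"
proof -
  have "x * y - \<Phi> x \<le> Lf y" unfolding Lf_def by (rule cSUP_upper[OF _ bdd_above_legendre]) simp
  then show ?thesis by simp
qed

lemma Lf_even: "Lf \<bar>y\<bar> = Lf y"
proof -
  have "Lf (- y) \<le> Lf y" for y
    unfolding Lf_def[of "- y"]
  proof (rule cSUP_least)
    show "x * (- y) - \<Phi> x \<le> Lf y" for x using young[of "- x" y] by (simp add: even)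
  qed simp
  from this[of y] this[of "- y"] have "Lf (- y) = Lf y" by simp
  then show ?thesis by (cases "0 \<le> y") simp_all
qed

lemma Lf_mono: "0 \<le> y \<Longrightarrow> y \<le> z \<Longrightarrow> Lf y \<le> Lf z"
  unfolding Lf_def[of y]
proof (rule cSUP_least)
  fix x assume yz: "0 \<le> y" "y \<le> z"
  have "x * y \<le> \<bar>x\<bar> * z" using yz by (intro mult_mono) auto
  then show "x * y - \<Phi> x \<le> Lf z" using young[of "\<bar>x\<bar>" z] by (simp add: even_abs)
qed simp

lemma Lf_measurable [measurable]: "Lf \<in> borel_measurable borel"
proof -
  have "mono (\<lambda>y. Lf (max 0 y))" by (intro monoI Lf_mono) auto
  then have m: "(\<lambda>y. Lf (max 0 y)) \<in> borel_measurable borel" by (rule borel_measurable_mono)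
  have "(\<lambda>y. Lf (max 0 \<bar>y\<bar>)) \<in> borel_measurable borel"
    by (rule measurable_compose[OF _ m]) simp
  then show ?thesis by (simp add: Lf_even)
qed

text \<open>
  The transform reverses the bound of the potential by a quadratic function; the argument x chosen in
  the proof is the maximizer for that function.
\<close>
lemma Lf_ge_square:
  assumes "2 * \<Phi> M / M \<le> \<bar>z\<bar>"
  shows "M\<^sup>2 / (4 * \<Phi> M) * z\<^sup>2 \<le> Lf z"
proof -
  define x where "x = M\<^sup>2 * \<bar>z\<bar> / (2 * \<Phi> M)"
  have "M \<le> x" using assms M by (simp add: x_def field_simps power2_eq_square)
  from \<Phi>_le_square[OF this] have "\<Phi> x \<le> M\<^sup>2 / (4 * \<Phi> M) * z\<^sup>2"
    using M by (simp add: x_def field_simps power2_eq_square)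
  moreover have "x * \<bar>z\<bar> = 2 * (M\<^sup>2 / (4 * \<Phi> M) * z\<^sup>2)"
    by (simp add: x_def power2_eq_square)
  ultimately show ?thesis
    using young[of x "\<bar>z\<bar>"] unfolding Lf_even by linarith
qed

end

section \<open>Integration by parts and the Poincare inequality\<close>

context intermediate_growth
begin

abbreviation \<mu> :: "real measure" where "\<mu> \<equiv> mu_measure \<Phi>"

definition w :: "real \<Rightarrow> real" where "w x = exp (- \<Phi> x) / Z_const \<Phi>"

text \<open>
  The tangent at M bounds the potential from below by an increasing linear function of the modulus.
\<close>
lemma integrable_exp_minus_\<Phi>: "integrable lborel (\<lambda>x. exp (- \<Phi> x))"
proof -
  define l where "l = \<Phi>' M"
  have l: "0 < l" using \<Phi>'_M_pos by (simp add: l_def)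
  define k where "k = (\<lambda>x::real. indicator {0..} x * exp (- l * x))"
  have km: "k \<in> borel_measurable borel" unfolding k_def by measurable
  have "((\<lambda>x. exp (- l * x)) has_integral exp (- l * 0) / l) {0..}"
    by (rule has_integral_exp_minus_to_infinity[OF l])
  then have "(\<lambda>x. exp (- l * x)) integrable_on {0..}" by blast
  then have "(\<lambda>x. exp (- l * x)) absolutely_integrable_on {0..}"
    by (rule nonnegative_absolutely_integrable_1) simp
  then have "integrable lebesgue k" by (simp add: set_integrable_def k_def)
  then have k: "integrable lborel k" using integrable_completion[of k lborel] km by simp
  have k': "integrable lborel (\<lambda>x. k (- x))"
    using lborel_integrable_real_affine[OF k, of "-1" 0] by simp
  let ?C = "exp (l * M - \<Phi> M)"
  show ?thesis
  proof (rule Bochner_Integration.integrable_bound)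
    show "integrable lborel (\<lambda>x. ?C * (k x + k (- x)))" using k k' by simp
    show "(\<lambda>x. exp (- \<Phi> x)) \<in> borel_measurable lborel"
      using continuous_\<Phi> by (auto intro!: borel_measurable_continuous_onI continuous_intros)
    have "exp (- \<Phi> x) \<le> ?C * (k x + k (- x))" for x
    proof -
      have "\<Phi> M + l * (\<bar>x\<bar> - M) \<le> \<Phi> x"
        using above_tangent[of M "\<bar>x\<bar>"] by (simp add: l_def even_abs)
      then have "exp (- \<Phi> x) \<le> exp ((l * M - \<Phi> M) + (- l * \<bar>x\<bar>))" by (simp add: algebra_simps)
      also have "\<dots> = ?C * exp (- l * \<bar>x\<bar>)" by (rule exp_add)
      also have "\<dots> \<le> ?C * (k x + k (- x))"
        by (intro mult_left_mono) (auto simp: k_def indicator_def abs_if)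
      finally show ?thesis .
    qed
    then show "AE x in lborel. norm (exp (- \<Phi> x)) \<le> norm (?C * (k x + k (- x)))"
      by (intro AE_I2) (simp add: order_trans[OF _ abs_ge_self])
  qed
qed

lemma Z_pos: "0 < Z_const \<Phi>"
proof -
  have "0 \<le> Z_const \<Phi>" unfolding Z_const_def by (intro integral_nonneg_AE) auto
  moreover have "Z_const \<Phi> \<noteq> 0"
  proof
    assume "Z_const \<Phi> = 0"
    then have "AE x in lborel. exp (- \<Phi> x) = 0"
      unfolding Z_const_def
      using integral_nonneg_eq_0_iff_AE[OF integrable_exp_minus_\<Phi>] by simp
    then have "AE x in (lborel :: real measure). False" by simp
    then have "UNIV \<in> null_sets (lborel :: real measure)"
      using AE_iff_null_sets[of UNIV "lborel :: real measure"] by simp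
    then show False by (simp add: null_sets_def)
  qed
  ultimately show ?thesis by simp
qed

lemma w_pos: "0 < w x"
  using Z_pos by (simp add: w_def)

lemma w_nonneg [simp]: "0 \<le> w x"
  using w_pos[of x] by simp

lemma continuous_w: "continuous_on UNIV w"
  unfolding w_def by (intro continuous_intros continuous_\<Phi>) (use Z_pos in auto)

lemma w_measurable [measurable]: "w \<in> borel_measurable borel"
  by (intro borel_measurable_continuous_onI continuous_w)

lemma w_deriv: "(w has_real_derivative - \<Phi>' x * w x) (at x)"
proof -
  have "((\<lambda>x. exp (- \<Phi> x)) has_real_derivative exp (- \<Phi> x) * (- \<Phi>' x)) (at x)"
    by (rule DERIV_chain2[OF DERIV_exp DERIV_minus[OF deriv1]])
  from DERIV_cdivide[OF this, of "Z_const \<Phi>"] show ?thesis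
    unfolding w_def by (simp add: mult.commute)
qed

lemma \<mu>_eq: "\<mu> = density lborel (\<lambda>x. ennreal (w x))"
  by (simp add: mu_measure_def w_def)

lemma sets_\<mu> [measurable_cong, simp]: "sets \<mu> = sets borel"
  by (simp add: \<mu>_eq)

lemma space_\<mu> [simp]: "space \<mu> = UNIV"
  by (simp add: \<mu>_eq)

lemma integrable_\<mu>_iff:
  fixes g :: "real \<Rightarrow> real"
  assumes "g \<in> borel_measurable borel"
  shows "integrable \<mu> g \<longleftrightarrow> integrable lborel (\<lambda>x. g x * w x)"
  unfolding \<mu>_eq using assms by (subst integrable_density) (auto simp: mult.commute)

lemma integral_\<mu>:
  fixes g :: "real \<Rightarrow> real"
  assumes "g \<in> borel_measurable borel"
  shows "(\<integral>x. g x \<partial>\<mu>) = (\<integral>x. g x * w x \<partial>lborel)"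
  unfolding \<mu>_eq using assms by (subst integral_density) (auto simp: mult.commute)

lemma integrable_\<mu>_measurable: "integrable \<mu> g \<Longrightarrow> g \<in> borel_measurable borel" for g :: "real \<Rightarrow> real"
  using borel_measurable_integrable[of \<mu> g] by (simp cong: measurable_cong_sets)

lemma integrable_w: "integrable lborel w" and integral_w: "(\<integral>x. w x \<partial>lborel) = 1"
proof -
  show "integrable lborel w" unfolding w_def using integrable_exp_minus_\<Phi> by simp
  have "(\<integral>x. w x \<partial>lborel) = (\<integral>x. exp (- \<Phi> x) \<partial>lborel) / Z_const \<Phi>" unfolding w_def by simp
  also have "\<dots> = 1" unfolding Z_const_def[symmetric] using Z_pos by simp
  finally show "(\<integral>x. w x \<partial>lborel) = 1" .
qed

lemma integrable_const_\<mu> [simp]: "integrable \<mu> (\<lambda>x. c :: real)"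
  using integrable_w by (subst integrable_\<mu>_iff) auto

lemma measure_\<mu> [simp]: "measure \<mu> UNIV = 1"
proof -
  have "(\<integral>x. (1::real) \<partial>\<mu>) = 1" by (subst integral_\<mu>) (auto simp: integral_w)
  then show ?thesis unfolding lebesgue_integral_const space_\<mu> by simp
qed

lemma AE_\<mu>: "(AE x in lborel. P x) \<Longrightarrow> AE x in \<mu>. P x"
  unfolding \<mu>_eq by (subst AE_density) auto

text \<open>
  Integration by parts against the weight w with a vector field \<xi>, whose divergence with respect to
  w is - (\<xi> \<Phi>' - \<xi>'). Half of the left-hand side is absorbed; what remains is the integral of r.
\<close>
lemma by_parts_absorb:
  assumes G: "ac_derivative G G'"
    and \<xi>: "\<And>x. (\<xi> has_real_derivative \<xi>' x) (at x)" "continuous_on UNIV \<xi>'"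
    and ab: "a \<le> b" "G a * (\<xi> a * w a) \<le> G b * (\<xi> b * w b)"
    and r: "integrable \<mu> r" "\<And>x. 0 \<le> r x"
    and absorb: "\<And>x. x \<in> {a..b} \<Longrightarrow> G' x * \<xi> x \<le> 1/2 * (G x * (\<xi> x * \<Phi>' x - \<xi>' x)) + r x"
  shows "integral {a..b} (\<lambda>x. G x * (\<xi> x * \<Phi>' x - \<xi>' x) * w x) \<le> 2 * (\<integral>x. r x \<partial>\<mu>)"
proof -
  have cont\<xi>: "continuous_on UNIV \<xi>"
    using DERIV_isCont[OF \<xi>(1)] by (simp add: continuous_at_imp_continuous_on)
  have contw': "continuous_on UNIV (\<lambda>x. - \<Phi>' x * w x)"
    by (intro continuous_intros continuous_\<Phi>' continuous_w)
  define T where "T = (\<lambda>x. G x * (\<xi> x * \<Phi>' x - \<xi>' x) * w x)"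
  have contT: "continuous_on UNIV T"
    unfolding T_def
    by (intro continuous_intros ac_derivative_continuous[OF G] cont\<xi> continuous_\<Phi>' \<xi>(2) continuous_w)
  have Tint: "T integrable_on {a..b}"
    by (rule integrable_continuous_interval[OF continuous_on_subset[OF contT]]) simp
  let ?P = "\<lambda>x. G x * (\<xi> x * w x)"
  let ?P' = "\<lambda>x. G' x * (\<xi> x * w x) + G x * (\<xi>' x * w x + \<xi> x * (- \<Phi>' x * w x))"
  have "ac_derivative ?P ?P'"
    by (intro ac_derivative_mult G ac_derivative_C1[OF \<xi>] ac_derivative_C1[OF w_deriv contw'])
  from ac_derivative_has_integral[OF this ab(1)]
  have P': "(?P' has_integral ?P b - ?P a) {a..b}" .
  have eq: "?P' x + T x = G' x * \<xi> x * w x" for x by (simp add: T_def algebra_simps)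
  have "((\<lambda>x. ?P' x + T x) has_integral (?P b - ?P a) + integral {a..b} T) {a..b}"
    by (rule has_integral_add[OF P' integrable_integral[OF Tint]])
  then have Gi: "((\<lambda>x. G' x * \<xi> x * w x) has_integral (?P b - ?P a) + integral {a..b} T) {a..b}"
    by (simp only: eq)
  have rl: "integrable lborel (\<lambda>x. r x * w x)"
    using r(1) integrable_\<mu>_iff integrable_\<mu>_measurable by blast
  have ri: "(\<lambda>x. r x * w x) integrable_on UNIV" by (rule integrable_on_lborel[OF rl])
  have ri': "(\<lambda>x. r x * w x) integrable_on {a..b}"
  proof -
    have "set_integrable lborel {a..b} (\<lambda>x. r x * w x)"
      using rl unfolding set_integrable_def by (intro integrable_mult_indicator) auto
    then show ?thesis by (rule set_borel_integral_eq_integral(1))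
  qed
  have "(?P b - ?P a) + integral {a..b} T \<le> integral {a..b} (\<lambda>x. 1/2 * T x + r x * w x)"
  proof (rule has_integral_le[OF Gi integrable_integral])
    show "(\<lambda>x. 1/2 * T x + r x * w x) integrable_on {a..b}"
      using Tint ri' by (intro integrable_add integrable_on_cmult_left) auto
    fix x assume "x \<in> {a..b}"
    from absorb[OF this] have "G' x * \<xi> x * w x \<le> (1/2 * (G x * (\<xi> x * \<Phi>' x - \<xi>' x)) + r x) * w x"
      by (intro mult_right_mono) auto
    then show "G' x * \<xi> x * w x \<le> 1/2 * T x + r x * w x" by (simp add: T_def algebra_simps)
  qed
  also have "\<dots> = 1/2 * integral {a..b} T + integral {a..b} (\<lambda>x. r x * w x)"
    using Tint ri' by (subst Henstock_Kurzweil_Integration.integral_add) auto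
  also have "integral {a..b} (\<lambda>x. r x * w x) \<le> integral UNIV (\<lambda>x. r x * w x)"
    using ri ri' r(2) by (intro integral_subset_le) auto
  also have "\<dots> = (\<integral>x. r x \<partial>\<mu>)"
    using integral_lborel[OF rl] integral_\<mu>[OF integrable_\<mu>_measurable[OF r(1)]] by simp
  finally show ?thesis using ab(2) by (simp add: T_def)
qed

lemma integrable_if_bounded_on_intervals:
  assumes k: "continuous_on UNIV k" "\<And>x. 0 \<le> k x"
    and bd: "\<And>n::nat. integral {- real n..real n} (\<lambda>x. k x * w x) \<le> c"
  shows "integrable \<mu> k" "(\<integral>x. k x \<partial>\<mu>) \<le> c"
proof -
  let ?g = "\<lambda>x. k x * w x"
  have km: "k \<in> borel_measurable borel" using k(1) by (rule borel_measurable_continuous_onI)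
  have gc: "continuous_on UNIV ?g" by (intro continuous_intros k(1) continuous_w)
  have c: "0 \<le> c" using bd[of 0] by simp
  define D where "D = density lborel (\<lambda>x. ennreal (?g x))"
  have bnd: "emeasure D {- real n..real n} \<le> ennreal c" for n
  proof -
    have si: "set_integrable lborel {- real n..real n} ?g"
      by (rule borel_integrable_atLeastAtMost'[OF continuous_on_subset[OF gc]]) simp
    have "emeasure D {- real n..real n} = (\<integral>\<^sup>+x. ennreal (?g x) * indicator {- real n..real n} x \<partial>lborel)"
      unfolding D_def using km by (subst emeasure_density) auto
    also have "\<dots> = (\<integral>\<^sup>+x. ennreal (indicator {- real n..real n} x *\<^sub>R ?g x) \<partial>lborel)"
      by (intro nn_integral_cong) (auto simp: indicator_def)
    also have "\<dots> = ennreal (LINT x:{- real n..real n}|lborel. ?g x)"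
      unfolding set_lebesgue_integral_def
      by (rule nn_integral_eq_integral) (use si k(2) in \<open>auto simp: set_integrable_def\<close>)
    also have "\<dots> = ennreal (integral {- real n..real n} ?g)"
      using set_borel_integral_eq_integral(2)[OF si] by simp
    also have "\<dots> \<le> ennreal c" using bd by (rule ennreal_leI)
    finally show ?thesis .
  qed
  have "(SUP n. emeasure D {- real n..real n}) \<le> ennreal c" by (rule SUP_least) (rule bnd)
  moreover have "(SUP n. emeasure D {- real n..real n}) = emeasure D (\<Union>n. {- real n..real n})"
    by (rule SUP_emeasure_incseq) (auto simp: D_def incseq_def)
  moreover have "(\<Union>n. {- real n..real n}) = UNIV"
  proof (intro equalityI subsetI)
    fix x :: real
    obtain n :: nat where "\<bar>x\<bar> \<le> real n" using real_arch_simple by blast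
    then have "x \<in> {- real n..real n}" by auto
    then show "x \<in> (\<Union>n. {- real n..real n})" by blast
  qed simp
  moreover have "emeasure D UNIV = (\<integral>\<^sup>+x. ennreal (?g x) \<partial>lborel)"
    unfolding D_def using km by (subst emeasure_density) auto
  ultimately have le: "(\<integral>\<^sup>+x. ennreal (?g x) \<partial>lborel) \<le> ennreal c" by simp
  have gi: "integrable lborel ?g"
    using km le k(2) by (intro integrableI_nonneg) (auto intro: le_less_trans)
  then show "integrable \<mu> k" using integrable_\<mu>_iff[OF km] by simp
  have "ennreal (\<integral>x. ?g x \<partial>lborel) \<le> ennreal c"
    using le nn_integral_eq_integral[OF gi] k(2) by simp
  then show "(\<integral>x. k x \<partial>\<mu>) \<le> c" using c by (simp add: integral_\<mu>[OF km])
qed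

definition \<kappa> :: real where "\<kappa> = min (exp (- M)) (\<Phi>' M)"

lemma \<kappa>_pos: "0 < \<kappa>" using \<Phi>'_M_pos by (simp add: \<kappa>_def)

text \<open>
  The field 1 + exp (- x) on the half line is bounded and its divergence with respect to w stays away
  from zero: near the origin because of the decreasing exponential, far out because \<Phi>' is.
\<close>
lemma \<kappa>_le: "0 \<le> x \<Longrightarrow> \<kappa> \<le> (1 + exp (- x)) * \<Phi>' x + exp (- x)"
proof -
  assume x: "0 \<le> x"
  have n: "0 \<le> \<Phi>' x" "0 \<le> exp (- x) * \<Phi>' x" using \<Phi>'_nonneg[OF x] by auto
  show ?thesis
  proof (cases "x \<le> M")
    case True
    then have "\<kappa> \<le> exp (- x)" by (auto simp: \<kappa>_def intro: min.coboundedI1)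
    then show ?thesis using n unfolding distrib_right mult_1 by linarith
  next
    case False
    then have "\<kappa> \<le> \<Phi>' x" using \<Phi>'_mono[of M x] by (auto simp: \<kappa>_def intro: min.coboundedI2)
    moreover have "0 < exp (- x)" by simp
    ultimately show ?thesis using n unfolding distrib_right mult_1 by linarith
  qed
qed

text \<open>
  The Poincare inequality, in the form of a Hardy inequality on each half line for functions that
  vanish at the origin. It includes that the left-hand side is finite.
\<close>
lemma poincare_origin:
  assumes f: "ac_derivative f f'" and f': "integrable \<mu> (\<lambda>x. (f' x)\<^sup>2)"
  shows "integrable \<mu> (\<lambda>x. (f x - f 0)\<^sup>2)"
    "(\<integral>x. (f x - f 0)\<^sup>2 \<partial>\<mu>) \<le> 32 / \<kappa>\<^sup>2 * (\<integral>x. (f' x)\<^sup>2 \<partial>\<mu>)"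
proof -
  define h where "h = (\<lambda>x. f x - f 0)"
  define G where "G = (\<lambda>x. (h x)\<^sup>2)"
  have G: "ac_derivative G (\<lambda>x. 2 * h x * f' x)"
    unfolding G_def h_def
    by (rule ac_derivative_compose[OF f, of UNIV "\<lambda>y. (y - f 0)\<^sup>2" "\<lambda>y. 2 * (y - f 0)"])
      (auto intro!: derivative_eq_intros continuous_intros)
  have contG: "continuous_on UNIV G" by (rule ac_derivative_continuous[OF G])
  let ?I = "\<integral>x. (f' x)\<^sup>2 \<partial>\<mu>"
  define r where "r = (\<lambda>x. 8 / \<kappa> * (f' x)\<^sup>2)"
  have r: "integrable \<mu> r" "\<And>x. 0 \<le> r x" "(\<integral>x. r x \<partial>\<mu>) = 8 / \<kappa> * ?I"
    using f' \<kappa>_pos by (auto simp: r_def)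
  \<comment> \<open>The weights in the arithmetic-geometric mean inequality are such that exactly half of the lower
      bound \<kappa> for the divergence is used up.\<close>
  have absorb: "2 * h x * f' x * \<xi> \<le> 1/2 * (G x * T) + r x" if "\<bar>\<xi>\<bar> \<le> 2" "\<kappa> \<le> T" for x \<xi> T
  proof -
    have "2 * h x * f' x * \<xi> \<le> \<bar>2 * h x * f' x * \<xi>\<bar>" by simp
    also have "\<dots> = 2 * \<bar>h x\<bar> * \<bar>f' x\<bar> * \<bar>\<xi>\<bar>" by (simp add: abs_mult)
    also have "\<dots> \<le> 2 * \<bar>h x\<bar> * \<bar>f' x\<bar> * 2" using that by (intro mult_left_mono) auto
    also have "\<dots> \<le> 1/2 * (\<kappa> * (h x)\<^sup>2) + 8 / \<kappa> * (f' x)\<^sup>2"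
    proof -
      have "0 \<le> (\<kappa> * \<bar>h x\<bar> - 4 * \<bar>f' x\<bar>)\<^sup>2 / (2 * \<kappa>)" using \<kappa>_pos by simp
      also have "\<dots> = 1/2 * (\<kappa> * (h x)\<^sup>2) + 8 / \<kappa> * (f' x)\<^sup>2 - 2 * \<bar>h x\<bar> * \<bar>f' x\<bar> * 2"
        using \<kappa>_pos by (simp add: power2_diff power_mult_distrib field_simps) (simp add: power2_eq_square)
      finally show ?thesis by simp
    qed
    also have "\<kappa> * (h x)\<^sup>2 \<le> T * (h x)\<^sup>2" using that by (intro mult_right_mono) auto
    finally show ?thesis by (simp add: G_def r_def mult.commute)
  qed
  have right: "\<kappa> * integral {0..real n} (\<lambda>x. G x * w x) \<le> 16 / \<kappa> * ?I" for n
  proof -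
    let ?T = "\<lambda>x. (1 + exp (- x)) * \<Phi>' x - (- exp (- x))"
    have "\<kappa> * integral {0..real n} (\<lambda>x. G x * w x) = integral {0..real n} (\<lambda>x. \<kappa> * (G x * w x))" by simp
    also have "\<dots> \<le> integral {0..real n} (\<lambda>x. G x * ?T x * w x)"
    proof (rule integral_le)
      show "(\<lambda>x. \<kappa> * (G x * w x)) integrable_on {0..real n}" "(\<lambda>x. G x * ?T x * w x) integrable_on {0..real n}"
        by (intro integrable_continuous_interval continuous_intros
            continuous_on_subset[OF contG] continuous_on_subset[OF continuous_w] continuous_on_subset[OF continuous_\<Phi>']; simp)+
      fix x assume "x \<in> {0..real n}"
      then have "G x * w x * \<kappa> \<le> G x * w x * ?T x"
        using \<kappa>_le[of x] by (intro mult_left_mono) (auto simp: G_def)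
      then show "\<kappa> * (G x * w x) \<le> G x * ?T x * w x" by (simp add: mult_ac)
    qed
    also have "\<dots> \<le> 2 * (\<integral>x. r x \<partial>\<mu>)"
    proof (rule by_parts_absorb[OF G _ _ _ _ r(1,2)])
      show "((\<lambda>x. 1 + exp (- x)) has_real_derivative - exp (- x)) (at x)" for x :: real
        by (auto intro!: derivative_eq_intros)
      show "continuous_on UNIV (\<lambda>x::real. - exp (- x))" by (intro continuous_intros)
      show "G 0 * ((1 + exp (- 0)) * w 0) \<le> G (real n) * ((1 + exp (- real n)) * w (real n))"
        by (simp add: G_def h_def add_nonneg_nonneg)
      fix x assume "x \<in> {0..real n}"
      then show "2 * h x * f' x * (1 + exp (- x)) \<le> 1/2 * (G x * ?T x) + r x"
        using \<kappa>_le[of x] by (intro absorb) auto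
    qed simp
    finally show ?thesis by (simp add: r(3))
  qed
  have left: "\<kappa> * integral {- real n..0} (\<lambda>x. G x * w x) \<le> 16 / \<kappa> * ?I" for n
  proof -
    let ?T = "\<lambda>x. (- 1 - exp x) * \<Phi>' x - (- exp x)"
    have T: "\<kappa> \<le> ?T x" if "x \<le> 0" for x
      using \<kappa>_le[of "- x"] that by (simp add: \<Phi>'_odd algebra_simps)
    have "\<kappa> * integral {- real n..0} (\<lambda>x. G x * w x) = integral {- real n..0} (\<lambda>x. \<kappa> * (G x * w x))" by simp
    also have "\<dots> \<le> integral {- real n..0} (\<lambda>x. G x * ?T x * w x)"
    proof (rule integral_le)
      show "(\<lambda>x. \<kappa> * (G x * w x)) integrable_on {- real n..0}" "(\<lambda>x. G x * ?T x * w x) integrable_on {- real n..0}"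
        by (intro integrable_continuous_interval continuous_intros
            continuous_on_subset[OF contG] continuous_on_subset[OF continuous_w] continuous_on_subset[OF continuous_\<Phi>']; simp)+
      fix x assume "x \<in> {- real n..0}"
      then have "G x * w x * \<kappa> \<le> G x * w x * ?T x"
        using T[of x] by (intro mult_left_mono) (auto simp: G_def)
      then show "\<kappa> * (G x * w x) \<le> G x * ?T x * w x" by (simp add: mult_ac)
    qed
    also have "\<dots> \<le> 2 * (\<integral>x. r x \<partial>\<mu>)"
    proof (rule by_parts_absorb[OF G _ _ _ _ r(1,2)])
      show "((\<lambda>x. - 1 - exp x) has_real_derivative - exp x) (at x)" for x :: real
        by (auto intro!: derivative_eq_intros)
      show "continuous_on UNIV (\<lambda>x::real. - exp x)" by (intro continuous_intros)
      have "- 1 - exp (- real n) \<le> 0" using exp_gt_zero[of "- real n"] by linarith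
      then have "G (- real n) * ((- 1 - exp (- real n)) * w (- real n)) \<le> 0"
        by (intro mult_nonneg_nonpos[OF _ mult_nonpos_nonneg]) (simp_all add: G_def)
      then show "G (- real n) * ((- 1 - exp (- real n)) * w (- real n)) \<le> G 0 * ((- 1 - exp 0) * w 0)"
        by (simp add: G_def h_def)
      fix x assume "x \<in> {- real n..0}"
      moreover from this have "exp x \<le> 1" by simp
      then have "\<bar>- 1 - exp x\<bar> \<le> 2" using exp_gt_zero[of x] by linarith
      ultimately show "2 * h x * f' x * (- 1 - exp x) \<le> 1/2 * (G x * ?T x) + r x"
        using T[of x] by (intro absorb) auto
    qed simp
    finally show ?thesis by (simp add: r(3))
  qed
  have bd: "integral {- real n..real n} (\<lambda>x. G x * w x) \<le> 32 / \<kappa>\<^sup>2 * ?I" for n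
  proof -
    have "(\<lambda>x. G x * w x) integrable_on {- real n..real n}"
      by (intro integrable_continuous_interval continuous_intros
          continuous_on_subset[OF contG] continuous_on_subset[OF continuous_w]) auto
    then have "integral {- real n..real n} (\<lambda>x. G x * w x)
        = integral {- real n..0} (\<lambda>x. G x * w x) + integral {0..real n} (\<lambda>x. G x * w x)"
      using Henstock_Kurzweil_Integration.integral_combine[of "- real n" 0 "real n" "\<lambda>x. G x * w x"] by simp
    then have "\<kappa> * integral {- real n..real n} (\<lambda>x. G x * w x) \<le> \<kappa> * (32 / \<kappa>\<^sup>2 * ?I)"
      using left[of n] right[of n] \<kappa>_pos by (simp add: algebra_simps power2_eq_square)
    then show ?thesis by (rule mult_le_cancel_left_pos[OF \<kappa>_pos, THEN iffD1])
  qed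
  have "\<And>x. 0 \<le> G x" by (simp add: G_def)
  from integrable_if_bounded_on_intervals[OF contG this bd]
  show "integrable \<mu> (\<lambda>x. (f x - f 0)\<^sup>2)"
    "(\<integral>x. (f x - f 0)\<^sup>2 \<partial>\<mu>) \<le> 32 / \<kappa>\<^sup>2 * ?I"
    by (simp_all add: G_def h_def)
qed

end

section \<open>Truncation and the energy density\<close>

definition cut :: "real \<Rightarrow> real" where "cut y = max 0 (1 - 2 / y)"

text \<open>
  The truncation of the square of y to the region y > 2. The threshold must exceed 1, the constant to
  which f is close; the high power of the cutoff makes the truncation continuously differentiable and
  lets the truncation absorb the derivative of the cutoff.
\<close>
definition trunc_sq :: "nat \<Rightarrow> real \<Rightarrow> real" where "trunc_sq k y = y\<^sup>2 * cut y ^ Suc k"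

definition trunc_sq' :: "nat \<Rightarrow> real \<Rightarrow> real" where
  "trunc_sq' k y = cut y ^ k * (2 * y * cut y + 2 * real (Suc k))"

lemma cut_nonneg [simp]: "0 \<le> cut y" and cut_le_1: "0 < y \<Longrightarrow> cut y \<le> 1"
  by (auto simp: cut_def)

lemma cut_pos_iff: "0 < y \<Longrightarrow> 0 < cut y \<longleftrightarrow> 2 < y"
  by (auto simp: cut_def less_max_iff_disj field_simps)

lemma has_real_derivative_max_power:
  assumes "0 < k"
  shows "((\<lambda>t::real. max 0 t ^ Suc k) has_real_derivative real (Suc k) * max 0 t ^ k) (at t)"
proof (cases t "0::real" rule: linorder_cases)
  case less
  have "((\<lambda>t::real. 0) has_real_derivative real (Suc k) * max 0 t ^ k) (at t)"
    using less assms by (simp add: power_0_left)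
  then show ?thesis
    by (rule has_field_derivative_transform_within_open[where S = "{..<0}"]) (use less in auto)
next
  case greater
  have "((\<lambda>t::real. t ^ Suc k) has_real_derivative real (Suc k) * max 0 t ^ k) (at t)"
    using greater DERIV_pow[of "Suc k" t] by simp
  then show ?thesis
    by (rule has_field_derivative_transform_within_open[where S = "{0<..}"]) (use greater in auto)
next
  case equal
  have "isCont (\<lambda>h::real. max 0 h ^ k) 0" by (intro continuous_intros)
  then have "((\<lambda>h::real. max 0 h ^ k) \<longlongrightarrow> 0) (at 0)"
    unfolding isCont_def using zero_power[OF assms, where 'a=real] by (simp del: power_eq_0_iff)
  moreover have "eventually (\<lambda>h::real. max 0 h ^ k = (max 0 (0 + h) ^ Suc k - max 0 0 ^ Suc k) / h) (at 0)"
    unfolding eventually_at by (intro exI[of _ 1]) (use assms in \<open>auto simp: max_def\<close>)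
  ultimately have "((\<lambda>h::real. (max 0 (0 + h) ^ Suc k - max 0 0 ^ Suc k) / h) \<longlongrightarrow> 0) (at 0)"
    by (rule Lim_transform_eventually)
  then show ?thesis unfolding DERIV_def equal using assms by (simp add: power_0_left)
qed

lemma trunc_sq_deriv:
  assumes "0 < k" "0 < y"
  shows "(trunc_sq k has_real_derivative trunc_sq' k y) (at y)"
proof -
  have "((\<lambda>y. 1 - 2 / y) has_real_derivative 2 / y\<^sup>2) (at y)"
    using assms by (auto intro!: derivative_eq_intros simp: power2_eq_square)
  from DERIV_chain2[OF has_real_derivative_max_power[OF assms(1)] this]
  have "((\<lambda>y. cut y ^ Suc k) has_real_derivative real (Suc k) * cut y ^ k * (2 / y\<^sup>2)) (at y)"
    by (simp add: cut_def)
  moreover have "((\<lambda>y. y\<^sup>2) has_real_derivative 2 * y) (at y)"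
    by (auto intro!: derivative_eq_intros)
  ultimately have "((\<lambda>y. y\<^sup>2 * cut y ^ Suc k) has_real_derivative
      2 * y * cut y ^ Suc k + real (Suc k) * cut y ^ k * (2 / y\<^sup>2) * y\<^sup>2) (at y)"
    by (rule DERIV_mult[rotated])
  moreover have "2 * y * cut y ^ Suc k + real (Suc k) * cut y ^ k * (2 / y\<^sup>2) * y\<^sup>2 = trunc_sq' k y"
    using assms(2) by (simp add: trunc_sq'_def algebra_simps)
  moreover have "(\<lambda>y. y\<^sup>2 * cut y ^ Suc k) = trunc_sq k" by (simp add: trunc_sq_def fun_eq_iff)
  ultimately show ?thesis by simp
qed

lemma continuous_trunc_sq': "continuous_on {0<..} (trunc_sq' k)"
  unfolding trunc_sq'_def cut_def by (intro continuous_intros) auto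

lemma trunc_sq_nonneg: "0 < y \<Longrightarrow> 0 \<le> trunc_sq k y"
  by (simp add: trunc_sq_def)

lemma trunc_sq_le: "0 < y \<Longrightarrow> trunc_sq k y \<le> y\<^sup>2"
  unfolding trunc_sq_def using cut_le_1[of y] by (intro mult_left_le power_le_one) auto

lemma trunc_sq_eq_0: "0 < y \<Longrightarrow> y \<le> 2 \<Longrightarrow> trunc_sq k y = 0"
  using cut_pos_iff[of y] cut_nonneg[of y] unfolding trunc_sq_def by simp

text \<open>
  Differentiating the truncation loses one power of the cutoff and no more.
\<close>
lemma abs_trunc_sq'_le:
  assumes "2 < y"
  shows "\<bar>trunc_sq' k y\<bar> \<le> (real k + 3) * y * cut y ^ k"
proof -
  have c: "0 \<le> cut y" "cut y \<le> 1" using assms by (auto intro: cut_le_1)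
  have "2 * y * cut y \<le> 2 * y" using assms c by (auto intro: mult_left_le)
  moreover have "2 * real (Suc k) \<le> y * real (Suc k)" using assms by (intro mult_right_mono) auto
  ultimately have "2 * y * cut y + 2 * real (Suc k) \<le> (real k + 3) * y" by (simp add: algebra_simps)
  then have "cut y ^ k * (2 * y * cut y + 2 * real (Suc k)) \<le> cut y ^ k * ((real k + 3) * y)"
    using c by (intro mult_left_mono) auto
  moreover have "0 \<le> trunc_sq' k y" unfolding trunc_sq'_def using assms c by simp
  ultimately show ?thesis by (simp add: trunc_sq'_def mult_ac)
qed

lemma trunc_sq'_eq_0: "0 < k \<Longrightarrow> 0 < y \<Longrightarrow> y \<le> 2 \<Longrightarrow> trunc_sq' k y = 0"
  using cut_pos_iff[of y] cut_nonneg[of y] unfolding trunc_sq'_def by simp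

lemma trunc_sq_ge: "4 < y \<Longrightarrow> y\<^sup>2 \<le> 2 ^ Suc k * trunc_sq k y"
proof -
  assume y: "4 < y"
  then have "1 / 2 \<le> cut y" by (simp add: cut_def field_simps le_max_iff_disj)
  then have "(1/2) ^ Suc k \<le> cut y ^ Suc k" by (intro power_mono) auto
  have "y\<^sup>2 = y\<^sup>2 * (2 * (1/2)) ^ Suc k" by simp
  also have "\<dots> = 2 ^ Suc k * (y\<^sup>2 * (1/2) ^ Suc k)"
    by (simp only: power_mult_distrib mult_ac)
  also have "\<dots> \<le> 2 ^ Suc k * (y\<^sup>2 * cut y ^ Suc k)"
    using \<open>(1/2) ^ Suc k \<le> cut y ^ Suc k\<close> by (intro mult_left_mono) auto
  finally show ?thesis by (simp add: trunc_sq_def)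
qed

context intermediate_growth
begin

text \<open>
  N is the constant in the bound for the derivative of the truncation, and B = 2 N makes the multiple of
  the potential in Young's inequality small enough to be absorbed. D is the threshold from which on the
  transform of B x is at least quadratic; below it, K bounds that transform. The energy density H
  dominates c times the square, which in particular makes it nonnegative.
\<close>
definition k :: nat where "k = nat \<lceil>1 / \<epsilon>\<rceil>"
definition N :: real where "N = real k + 3"
definition B :: real where "B = 2 * N"
definition D :: real where "D = 2 * \<Phi> M / M / B"
definition H :: "real \<Rightarrow> real" where "H x = (if \<bar>x\<bar> > D then Lf (B * x) else x\<^sup>2)"
definition c :: real where "c = min 1 (B\<^sup>2 * (M\<^sup>2 / (4 * \<Phi> M)))"
definition K :: real where "K = \<bar>Lf (B * D)\<bar>"

lemma k_eps: "1 \<le> real k * \<epsilon>" "0 < k"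
proof -
  have "1 / \<epsilon> \<le> real k" unfolding k_def by linarith
  then show "1 \<le> real k * \<epsilon>" using eps(1) by (simp add: field_simps)
  then show "0 < k" by (cases k) auto
qed

lemma N_pos: "0 < N" and B_pos: "0 < B" and D_pos: "0 < D" and c_pos: "0 < c" and c_le: "c \<le> 1"
proof -
  show N: "0 < N" by (simp add: N_def)
  then show B: "0 < B" by (simp add: B_def)
  then show "0 < D" using M by (simp add: D_def)
  show "0 < c" "c \<le> 1" using M B by (auto simp: c_def)
qed

lemma H_fun_eq: "H_fun \<Phi> B D x = ereal (H x)"
  by (simp add: H_fun_def H_def legendre_fenchel_eq)

lemma H_measurable [measurable]: "H \<in> borel_measurable borel"
  unfolding H_def by measurable

lemma H_ge_square: "c * x\<^sup>2 \<le> H x"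
proof (cases "\<bar>x\<bar> > D")
  case True
  then have "2 * \<Phi> M / M \<le> \<bar>B * x\<bar>"
    using B_pos M by (simp add: D_def abs_mult field_simps)
  from Lf_ge_square[OF this] have "B\<^sup>2 * (M\<^sup>2 / (4 * \<Phi> M)) * x\<^sup>2 \<le> H x"
    using True by (simp add: H_def power_mult_distrib mult_ac)
  moreover have "c * x\<^sup>2 \<le> B\<^sup>2 * (M\<^sup>2 / (4 * \<Phi> M)) * x\<^sup>2"
    by (intro mult_right_mono) (auto simp: c_def)
  ultimately show ?thesis by linarith
next
  case False
  have "c * x\<^sup>2 \<le> 1 * x\<^sup>2" using c_le by (intro mult_right_mono) auto
  then show ?thesis using False by (simp add: H_def)
qed

lemma H_nonneg: "0 \<le> H x"
proof -
  have "0 \<le> c * x\<^sup>2" using c_pos by simp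
  then show ?thesis using H_ge_square[of x] by linarith
qed

lemma Lf_le_H: "Lf (B * x) \<le> H x + K"
proof (cases "\<bar>x\<bar> > D")
  case True
  then show ?thesis by (simp add: H_def K_def)
next
  case False
  then have "Lf \<bar>B * x\<bar> \<le> Lf (B * D)" using B_pos by (intro Lf_mono) (auto simp: abs_mult)
  then show ?thesis using H_nonneg[of x] by (simp add: Lf_even K_def)
qed

lemma abs_le_H: "\<bar>x\<bar> \<le> 1 / c * (1 + H x)"
proof -
  have "0 \<le> (\<bar>x\<bar> - 1)\<^sup>2" by simp
  then have "2 * \<bar>x\<bar> \<le> 1 + x\<^sup>2" by (simp add: power2_diff)
  then have "\<bar>x\<bar> \<le> 1 + x\<^sup>2" by simp
  then have "c * \<bar>x\<bar> \<le> c * (1 + x\<^sup>2)" using c_pos by (intro mult_left_mono) auto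
  also have "\<dots> \<le> 1 + H x" using H_ge_square[of x] c_le by (simp add: algebra_simps)
  finally show ?thesis using c_pos by (simp add: field_simps)
qed

text \<open>
  The exponent k is so large that contracting the potential by the factor u ^ k, where u is the
  cutoff, gains the full weight u ^ (k + 1) of the truncated function.
\<close>
lemma young_cut:
  assumes "0 \<le> u" "u \<le> 1"
  shows "N * (u ^ k * \<bar>x\<bar> * \<bar>y\<bar>) \<le> 1/2 * (u ^ Suc k * (x * \<Phi>' x)) + N * (\<Phi> M + K + H y)"
proof -
  define l where "l = u ^ k / B"
  have B: "1 \<le> B" by (simp add: B_def N_def)
  have uk: "0 \<le> u ^ k" "u ^ k \<le> 1" using assms by (auto intro: power_le_one)
  have "u ^ k / B \<le> u ^ k / 1" using uk B by (intro divide_left_mono) auto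
  then have l: "0 \<le> l" "l \<le> 1" "l \<le> u ^ k" using uk B by (auto simp: l_def)
  have "u ^ k * \<bar>x\<bar> * \<bar>y\<bar> = (l * \<bar>x\<bar>) * \<bar>B * y\<bar>" using B by (simp add: l_def abs_mult)
  also have "\<dots> \<le> \<Phi> (l * \<bar>x\<bar>) + Lf (B * y)"
    using young[of "l * \<bar>x\<bar>" "\<bar>B * y\<bar>"] by (simp add: Lf_even)
  also have "\<Phi> (l * \<bar>x\<bar>) \<le> u ^ Suc k / B * (x * \<Phi>' x) + \<Phi> M"
  proof (cases "M \<le> l * \<bar>x\<bar>")
    case True
    have lx: "0 < l * \<bar>x\<bar>" using True M by linarith
    then have lp: "0 < l" using l(1) by (cases "l = 0") auto
    then have up: "0 < u ^ k" using l(3) by linarith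
    then have u0: "0 < u" using assms zero_power[OF k_eps(2), where 'a=real] by (cases "u = 0") auto
    have "l * \<bar>x\<bar> \<le> \<bar>x\<bar>" using l by (intro mult_left_le_one_le) auto
    then have xM: "M \<le> \<bar>x\<bar>" using True by linarith
    have gain: "\<Phi> (l * \<bar>x\<bar>) \<le> l powr (1 + \<epsilon>) * \<Phi> \<bar>x\<bar>" by (rule \<Phi>_contract[OF True lp l(2)])
    have pw: "l powr (1 + \<epsilon>) \<le> u ^ Suc k / B"
    proof -
      have "l powr \<epsilon> \<le> (u ^ k) powr \<epsilon>" using l eps by (intro powr_mono2) auto
      also have "\<dots> = u powr (real k * \<epsilon>)" using u0 by (simp add: powr_realpow[symmetric] powr_powr)
      also have "\<dots> \<le> u powr 1" using k_eps u0 assms by (intro powr_mono') auto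
      finally have "l * l powr \<epsilon> \<le> l * u" using lp u0 by simp
      moreover have "l * u = u ^ Suc k / B" by (simp add: l_def)
      moreover have "l powr (1 + \<epsilon>) = l * l powr \<epsilon>" using lp by (simp add: powr_add)
      ultimately show ?thesis by simp
    qed
    have le: "\<Phi> \<bar>x\<bar> \<le> x * \<Phi>' x"
    proof -
      have "0 \<le> \<epsilon> * \<Phi> \<bar>x\<bar>" using eps \<Phi>_pos[OF xM] by simp
      then have "\<Phi> \<bar>x\<bar> \<le> (1 + \<epsilon>) * \<Phi> \<bar>x\<bar>" by (simp add: algebra_simps)
      then show ?thesis using growth[OF xM] \<Phi>'_abs[of x] by simp
    qed
    have "l powr (1 + \<epsilon>) * \<Phi> \<bar>x\<bar> \<le> u ^ Suc k / B * (x * \<Phi>' x)"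
      by (intro mult_mono pw le) (use \<Phi>_pos[OF xM] assms B in auto)
    with gain have "\<Phi> (l * \<bar>x\<bar>) \<le> u ^ Suc k / B * (x * \<Phi>' x)" by (rule order_trans)
    then show ?thesis using M by simp
  next
    case False
    then have "\<Phi> (l * \<bar>x\<bar>) \<le> \<Phi> M" using l by (intro \<Phi>_mono) auto
    moreover have "0 \<le> u ^ Suc k / B * (x * \<Phi>' x)"
      using assms B by (intro mult_nonneg_nonneg[OF _ xd\<Phi>_nonneg]) auto
    ultimately show ?thesis by simp
  qed
  also have "Lf (B * y) \<le> H y + K" by (rule Lf_le_H)
  finally have "N * (u ^ k * \<bar>x\<bar> * \<bar>y\<bar>) \<le> N * (u ^ Suc k / B * (x * \<Phi>' x) + \<Phi> M + (H y + K))"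
    using N_pos by (simp add: mult_left_mono)
  also have "\<dots> = 1/2 * (u ^ Suc k * (x * \<Phi>' x)) + N * (\<Phi> M + K + H y)"
    using N_pos by (simp add: B_def field_simps)
  finally show ?thesis .
qed

end

section \<open>The entropy estimate\<close>

context intermediate_growth
begin

text \<open>
  Twice the Poincare constant of the measure, divided by the constant c that compares the square of the
  derivative with the energy density.
\<close>
definition c0 :: real where "c0 = 64 / (\<kappa>\<^sup>2 * c)"

lemma c0_nonneg: "0 \<le> c0" using \<kappa>_pos c_pos by (simp add: c0_def)

text \<open>
  C1 is the constant left over in the moment estimate, C2 the one in the bound for the total variation
  of the truncated density, C3 the one in the bound of the logarithm, and C4 collects all of them.
\<close>
definition C1 :: real where "C1 = 1/2 + N * (\<Phi> M + K + 1)"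

lemma C1_nonneg: "0 \<le> C1"
  using N_pos M by (auto simp: C1_def K_def intro!: add_nonneg_nonneg mult_nonneg_nonneg)

definition C2 :: real where "C2 = N / c + \<Phi>' 1"

definition C3 :: real where "C3 = \<bar>real (Suc k) * ln 2 + \<Phi> M + ln (Z_const \<Phi>)\<bar>"

definition C4 :: real where
  "C4 = 9 * c0 + (C3 + (C2 + (2 * C1 + 1)) + 2 ^ Suc k * (2 * C1 + 1)) * (4 * c0 + 1)"

lemma C2_nonneg: "0 \<le> C2"
  using N_pos c_pos \<Phi>'_nonneg[of 1] by (simp add: C2_def)

lemma C4_nonneg: "0 \<le> C4"
  unfolding C4_def C3_def using C1_nonneg C2_nonneg c0_nonneg
  by (intro add_nonneg_nonneg mult_nonneg_nonneg) auto

text \<open>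
  The Poincare inequality presupposes only that the derivative is square integrable, which finite
  energy implies. Hence the entropy cannot be infinite merely because f is not square integrable.
\<close>
lemma integrable_square_if_energy:
  assumes f: "ac_derivative f f'" "\<And>x. 0 < f x"
    and I: "integrable \<mu> (\<lambda>x. H (f' x / f x) * (f x)\<^sup>2)"
  shows "integrable \<mu> (\<lambda>x. (f x)\<^sup>2)" "integrable \<mu> (\<lambda>x. (f x - f 0)\<^sup>2)"
    "2 * (\<integral>x. (f x - f 0)\<^sup>2 \<partial>\<mu>) \<le> c0 * (\<integral>x. H (f' x / f x) * (f x)\<^sup>2 \<partial>\<mu>)"
proof -
  have fm [measurable]: "f \<in> borel_measurable borel"
    using ac_derivative_continuous[OF f(1)] by (rule borel_measurable_continuous_onI)
  have f'm [measurable]: "f' \<in> borel_measurable borel" by (rule ac_derivative_measurable[OF f(1)])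
  have le: "(f' x)\<^sup>2 \<le> 1 / c * (H (f' x / f x) * (f x)\<^sup>2)" for x
  proof -
    have "c * (f' x / f x)\<^sup>2 * (f x)\<^sup>2 \<le> H (f' x / f x) * (f x)\<^sup>2"
      using H_ge_square by (intro mult_right_mono) auto
    moreover have "c * (f' x / f x)\<^sup>2 * (f x)\<^sup>2 = c * (f' x)\<^sup>2"
      using f(2)[of x] by (simp add: power_divide)
    ultimately show ?thesis using c_pos by (simp add: field_simps)
  qed
  have f': "integrable \<mu> (\<lambda>x. (f' x)\<^sup>2)"
  proof (rule Bochner_Integration.integrable_bound[OF integrable_mult_right[OF I, of "1 / c"]])
    have "norm ((f' x)\<^sup>2) \<le> norm (1 / c * (H (f' x / f x) * (f x)\<^sup>2))" for x
      using order_trans[OF le[of x] abs_ge_self] by (simp only: real_norm_def abs_power2)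
    then show "AE x in \<mu>. norm ((f' x)\<^sup>2) \<le> norm (1 / c * (H (f' x / f x) * (f x)\<^sup>2))"
      by (rule AE_I2)
  qed simp
  have "(\<integral>x. (f' x)\<^sup>2 \<partial>\<mu>) \<le> (\<integral>x. 1 / c * (H (f' x / f x) * (f x)\<^sup>2) \<partial>\<mu>)"
    by (rule integral_mono[OF f' integrable_mult_right[OF I] le])
  then have I': "(\<integral>x. (f' x)\<^sup>2 \<partial>\<mu>) \<le> 1 / c * (\<integral>x. H (f' x / f x) * (f x)\<^sup>2 \<partial>\<mu>)" by simp
  show h: "integrable \<mu> (\<lambda>x. (f x - f 0)\<^sup>2)" by (rule poincare_origin(1)[OF f(1) f'])
  have "2 * (\<integral>x. (f x - f 0)\<^sup>2 \<partial>\<mu>) \<le> 2 * (32 / \<kappa>\<^sup>2 * (1 / c * (\<integral>x. H (f' x / f x) * (f x)\<^sup>2 \<partial>\<mu>)))"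
    using poincare_origin(2)[OF f(1) f'] mult_left_mono[OF I', of "32 / \<kappa>\<^sup>2"] by simp
  then show "2 * (\<integral>x. (f x - f 0)\<^sup>2 \<partial>\<mu>) \<le> c0 * (\<integral>x. H (f' x / f x) * (f x)\<^sup>2 \<partial>\<mu>)"
    by (simp add: c0_def)
  show "integrable \<mu> (\<lambda>x. (f x)\<^sup>2)"
  proof (rule Bochner_Integration.integrable_bound)
    show "integrable \<mu> (\<lambda>x. 2 * (f x - f 0)\<^sup>2 + 2 * (f 0)\<^sup>2)" using h by simp
    have "(f x)\<^sup>2 \<le> 2 * (f x - f 0)\<^sup>2 + 2 * (f 0)\<^sup>2" for x
    proof -
      have "0 \<le> ((f x - f 0) - f 0)\<^sup>2" by simp
      then show ?thesis by (simp add: power2_eq_square algebra_simps)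
    qed
    then show "AE x in \<mu>. norm ((f x)\<^sup>2) \<le> norm (2 * (f x - f 0)\<^sup>2 + 2 * (f 0)\<^sup>2)"
      by (intro AE_I2) simp
  qed simp
qed

end

text \<open>
  By homogeneity the normalization is no restriction. It ties f to the constant 1, against which the
  large values of f are measured.
\<close>
locale finite_energy = intermediate_growth +
  fixes f f' :: "real \<Rightarrow> real"
  assumes f: "ac_derivative f f'" "\<And>x. 0 < f x"
    and energy: "integrable (mu_measure \<Phi>) (\<lambda>x. H (f' x / f x) * (f x)\<^sup>2)"
    and normalized: "(\<integral>x. (f x)\<^sup>2 \<partial>mu_measure \<Phi>) = 1"
begin

definition I :: real where "I = (\<integral>x. H (f' x / f x) * (f x)\<^sup>2 \<partial>\<mu>)"

lemma f_measurable [measurable]: "f \<in> borel_measurable borel"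
  using ac_derivative_continuous[OF f(1)] by (rule borel_measurable_continuous_onI)

lemma f'_measurable [measurable]: "f' \<in> borel_measurable borel"
  by (rule ac_derivative_measurable[OF f(1)])

lemma f_square: "integrable \<mu> (\<lambda>x. (f x)\<^sup>2)"
  by (rule integrable_square_if_energy(1)[OF f energy])

lemma f_integrable: "integrable \<mu> f"
proof (rule Bochner_Integration.integrable_bound)
  show "integrable \<mu> (\<lambda>x. 1 + (f x)\<^sup>2)" using f_square by simp
  have "\<bar>f x\<bar> \<le> 1 + (f x)\<^sup>2" for x
    using zero_le_power2[of "\<bar>f x\<bar> - 1"] zero_le_power2[of "f x"] by (simp add: power2_diff)
  then show "AE x in \<mu>. norm (f x) \<le> norm (1 + (f x)\<^sup>2)" by (intro AE_I2) simp
qed simp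

text \<open>
  Since f is positive with unit second moment, its mean is at most 1, and its distance to 1 is
  controlled by the distance to any other constant.
\<close>
lemma distance_to_one:
  shows "integrable \<mu> (\<lambda>x. (f x - 1)\<^sup>2)" "(\<integral>x. (f x - 1)\<^sup>2 \<partial>\<mu>) \<le> c0 * I"
proof -
  have exp: "(f x - a)\<^sup>2 = (f x)\<^sup>2 - 2 * a * f x + a\<^sup>2" for a x
    by (simp add: power2_diff)
  have int: "integrable \<mu> (\<lambda>x. (f x - a)\<^sup>2)" for a
    unfolding exp using f_square f_integrable by simp
  have val: "(\<integral>x. (f x - a)\<^sup>2 \<partial>\<mu>) = 1 - 2 * a * (\<integral>x. f x \<partial>\<mu>) + a\<^sup>2" for a
    unfolding exp using f_square f_integrable normalized by simp
  define m where "m = (\<integral>x. f x \<partial>\<mu>)"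
  have "0 \<le> m" unfolding m_def using f(2) by (intro integral_nonneg_AE AE_I2) (simp add: less_imp_le)
  moreover have "0 \<le> (\<integral>x. (f x - 1)\<^sup>2 \<partial>\<mu>)" by simp
  then have "m \<le> 1" using val[of 1] by (simp add: m_def)
  ultimately have "0 \<le> m * (1 - m)" by simp
  moreover have "0 \<le> (f 0 - m)\<^sup>2" by simp
  ultimately have "(\<integral>x. (f x - 1)\<^sup>2 \<partial>\<mu>) \<le> 2 * (\<integral>x. (f x - f 0)\<^sup>2 \<partial>\<mu>)"
    unfolding val m_def[symmetric] by (simp add: power2_eq_square algebra_simps)
  also have "\<dots> \<le> c0 * I"
    unfolding I_def by (rule integrable_square_if_energy(3)[OF f energy])
  finally show "(\<integral>x. (f x - 1)\<^sup>2 \<partial>\<mu>) \<le> c0 * I" .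
  show "integrable \<mu> (\<lambda>x. (f x - 1)\<^sup>2)" by (rule int)
qed

text \<open>
  The error terms of the moment and total variation estimates are supported where f exceeds 2 and are
  bounded by multiples of J. The mass contained in J is controlled by the energy, because f is at most 2 (f - 1) there.
\<close>
definition J :: "real \<Rightarrow> real" where
  "J x = (if 2 < f x then (f x)\<^sup>2 * (1 + H (f' x / f x)) else 0)"

lemma J_nonneg: "0 \<le> J x"
  using H_nonneg[of "f' x / f x"] by (simp add: J_def)

lemma square_le_J: "2 < f x \<Longrightarrow> (f x)\<^sup>2 \<le> J x"
  using H_nonneg[of "f' x / f x"] by (simp add: J_def distrib_left)

lemma J_bound:
  shows "integrable \<mu> J" "(\<integral>x. J x \<partial>\<mu>) \<le> (4 * c0 + 1) * I"
proof -
  let ?b = "\<lambda>x. 4 * (f x - 1)\<^sup>2 + H (f' x / f x) * (f x)\<^sup>2"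
  have bi: "integrable \<mu> ?b" using distance_to_one(1) energy by simp
  have le: "J x \<le> ?b x" for x
  proof (cases "2 < f x")
    case True
    then have "(f x)\<^sup>2 \<le> (2 * (f x - 1))\<^sup>2" by (intro power_mono) auto
    then have "(f x)\<^sup>2 \<le> 4 * (f x - 1)\<^sup>2" unfolding power_mult_distrib by simp
    then show ?thesis using True by (simp add: J_def distrib_left mult.commute)
  next
    case False
    then show ?thesis using H_nonneg[of "f' x / f x"] by (simp add: J_def)
  qed
  have Jm: "J \<in> borel_measurable borel" unfolding J_def by measurable
  show Ji: "integrable \<mu> J"
    by (rule Bochner_Integration.integrable_bound[OF bi])
      (use Jm le J_nonneg in \<open>auto intro!: AE_I2 order_trans[OF _ abs_ge_self]\<close>)
  have "(\<integral>x. J x \<partial>\<mu>) \<le> (\<integral>x. ?b x \<partial>\<mu>)" by (rule integral_mono[OF Ji bi le])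
  also have "\<dots> = 4 * (\<integral>x. (f x - 1)\<^sup>2 \<partial>\<mu>) + I" using distance_to_one(1) energy by (simp add: I_def)
  also have "\<dots> \<le> (4 * c0 + 1) * I" using distance_to_one(2) by (simp add: algebra_simps)
  finally show "(\<integral>x. J x \<partial>\<mu>) \<le> (4 * c0 + 1) * I" .
qed

definition G :: "real \<Rightarrow> real" where "G x = trunc_sq k (f x)"

definition G' :: "real \<Rightarrow> real" where "G' x = trunc_sq' k (f x) * f' x"

lemma G: "ac_derivative G G'"
  unfolding G_def G'_def
  by (rule ac_derivative_compose[OF f(1), of "{0<..}"])
    (use f(2) k_eps(2) in \<open>auto intro: trunc_sq_deriv continuous_trunc_sq'\<close>)

lemma G_continuous: "continuous_on UNIV G" by (rule ac_derivative_continuous[OF G])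

lemma G_nonneg: "0 \<le> G x" unfolding G_def by (rule trunc_sq_nonneg[OF f(2)])

lemma G_le_J: "G x \<le> J x"
proof (cases "2 < f x")
  case True
  then show ?thesis using trunc_sq_le[OF f(2), of k x] square_le_J[OF True] by (simp add: G_def)
next
  case False
  then show ?thesis using trunc_sq_eq_0[OF f(2), of x k] J_nonneg[of x] by (simp add: G_def)
qed

lemma abs_G'_le:
  assumes "2 < f x"
  shows "\<bar>G' x\<bar> \<le> N * cut (f x) ^ k * \<bar>f' x / f x\<bar> * (f x)\<^sup>2"
proof -
  have "\<bar>G' x\<bar> = \<bar>trunc_sq' k (f x)\<bar> * \<bar>f' x\<bar>" by (simp add: G'_def abs_mult)
  also have "\<dots> \<le> (N * f x * cut (f x) ^ k) * \<bar>f' x\<bar>"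
    using abs_trunc_sq'_le[OF assms, of k] by (intro mult_right_mono) (auto simp: N_def)
  also have "\<dots> = N * cut (f x) ^ k * \<bar>f' x / f x\<bar> * (f x)\<^sup>2"
    using f(2)[of x] by (simp add: abs_divide power2_eq_square)
  finally show ?thesis .
qed

lemma G'_eq_0: "f x \<le> 2 \<Longrightarrow> G' x = 0"
  using trunc_sq'_eq_0[OF k_eps(2) f(2)] by (simp add: G'_def)

text \<open>
  The vector field x yields the moment estimate: where f is large, its square integrates x \<Phi>'(x),
  hence the potential, with a bound in terms of the energy.
\<close>
lemma moment_bound:
  shows "integrable \<mu> (\<lambda>x. G x * (x * \<Phi>' x))"
    "(\<integral>x. G x * (x * \<Phi>' x) \<partial>\<mu>) \<le> (2 * C1 + 1) * (\<integral>x. J x \<partial>\<mu>)"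
proof -
  note Ji = J_bound(1)
  have bp: "integral {- real n..real n} (\<lambda>x. G x * (x * \<Phi>' x - 1) * w x) \<le> 2 * (\<integral>x. C1 * J x \<partial>\<mu>)" for n
  proof (rule by_parts_absorb[OF G])
    show "((\<lambda>x. x) has_real_derivative 1) (at x)" for x :: real by (rule DERIV_ident)
    have "G (- real n) * (- real n * w (- real n)) \<le> 0"
      by (intro mult_nonneg_nonpos[OF G_nonneg mult_nonpos_nonneg]) auto
    also have "0 \<le> G (real n) * (real n * w (real n))"
      using G_nonneg by simp
    finally show "G (- real n) * (- real n * w (- real n)) \<le> G (real n) * (real n * w (real n))" .
    show "0 \<le> C1 * J x" for x using C1_nonneg J_nonneg by simp
    fix x
    show "G' x * x \<le> 1/2 * (G x * (x * \<Phi>' x - 1)) + C1 * J x"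
    proof (cases "2 < f x")
      case True
      let ?u = "cut (f x)" and ?y = "f' x / f x"
      have u: "0 \<le> ?u" "?u \<le> 1" using cut_le_1[OF f(2)] by auto
      have "G' x * x \<le> \<bar>G' x\<bar> * \<bar>x\<bar>" by (simp add: abs_mult[symmetric])
      also have "\<dots> \<le> (N * ?u ^ k * \<bar>?y\<bar> * (f x)\<^sup>2) * \<bar>x\<bar>"
        by (intro mult_right_mono abs_G'_le[OF True]) auto
      also have "\<dots> = (N * (?u ^ k * \<bar>x\<bar> * \<bar>?y\<bar>)) * (f x)\<^sup>2" by simp
      also have "\<dots> \<le> (1/2 * (?u ^ Suc k * (x * \<Phi>' x)) + N * (\<Phi> M + K + H ?y)) * (f x)\<^sup>2"
        by (intro mult_right_mono young_cut u) auto
      also have "\<dots> = 1/2 * (G x * (x * \<Phi>' x)) + (f x)\<^sup>2 * (N * (\<Phi> M + K + H ?y))"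
        by (simp add: G_def trunc_sq_def algebra_simps)
      also have "\<dots> \<le> 1/2 * (G x * (x * \<Phi>' x - 1)) + C1 * J x"
      proof -
        have "N * (\<Phi> M + K + H ?y) \<le> N * (\<Phi> M + K + 1) * (1 + H ?y)"
        proof -
          have "0 \<le> (\<Phi> M + K) * H ?y" using M H_nonneg[of ?y] by (simp add: K_def)
          then have "\<Phi> M + K + H ?y \<le> (\<Phi> M + K + 1) * (1 + H ?y)" by (simp add: algebra_simps)
          then show ?thesis using N_pos by (simp add: mult.assoc)
        qed
        then have "(f x)\<^sup>2 * (N * (\<Phi> M + K + H ?y)) \<le> (f x)\<^sup>2 * (N * (\<Phi> M + K + 1) * (1 + H ?y))"
          by (intro mult_left_mono) auto
        also have "\<dots> = N * (\<Phi> M + K + 1) * J x" using True by (simp add: J_def)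
        finally show ?thesis using G_le_J[of x] by (simp add: C1_def algebra_simps)
      qed
      finally show ?thesis .
    next
      case False
      then have "G x = 0" "G' x = 0" using trunc_sq_eq_0[OF f(2), of x k] G'_eq_0 by (auto simp: G_def)
      then show ?thesis using C1_nonneg J_nonneg[of x] by simp
    qed
  qed (use Ji in auto)
  have "integral {- real n..real n} (\<lambda>x. G x * (x * \<Phi>' x) * w x) \<le> (2 * C1 + 1) * (\<integral>x. J x \<partial>\<mu>)" for n
  proof -
    have ig: "(\<lambda>x. G x * (x * \<Phi>' x - 1) * w x) integrable_on {- real n..real n}"
      "(\<lambda>x. G x * w x) integrable_on {- real n..real n}"
      by (intro integrable_continuous_interval continuous_intros continuous_on_subset[OF G_continuous]
          continuous_on_subset[OF continuous_\<Phi>'] continuous_on_subset[OF continuous_w]; simp)+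
    have Gi: "integrable \<mu> G"
      by (rule Bochner_Integration.integrable_bound[OF Ji])
        (use G_le_J G_nonneg borel_measurable_continuous_onI[OF G_continuous] in
          \<open>auto intro!: AE_I2 order_trans[OF _ abs_ge_self]\<close>)
    have Gl: "integrable lborel (\<lambda>x. G x * w x)"
      using Gi integrable_\<mu>_iff integrable_\<mu>_measurable by blast
    have "integral {- real n..real n} (\<lambda>x. G x * w x) \<le> integral UNIV (\<lambda>x. G x * w x)"
      using ig(2) integrable_on_lborel[OF Gl] G_nonneg by (intro integral_subset_le) auto
    also have "\<dots> = (\<integral>x. G x \<partial>\<mu>)"
      using integral_lborel[OF Gl] integral_\<mu>[OF integrable_\<mu>_measurable[OF Gi]] by simp
    also have "\<dots> \<le> (\<integral>x. J x \<partial>\<mu>)" by (rule integral_mono[OF Gi Ji G_le_J])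
    finally have "integral {- real n..real n} (\<lambda>x. G x * w x) \<le> (\<integral>x. J x \<partial>\<mu>)" .
    moreover have "integral {- real n..real n} (\<lambda>x. G x * (x * \<Phi>' x) * w x)
        = integral {- real n..real n} (\<lambda>x. G x * (x * \<Phi>' x - 1) * w x + G x * w x)"
      by (rule Henstock_Kurzweil_Integration.integral_cong) (simp add: algebra_simps)
    moreover have "\<dots> = integral {- real n..real n} (\<lambda>x. G x * (x * \<Phi>' x - 1) * w x)
        + integral {- real n..real n} (\<lambda>x. G x * w x)"
      by (rule Henstock_Kurzweil_Integration.integral_add[OF ig])
    moreover have "2 * (\<integral>x. C1 * J x \<partial>\<mu>) = 2 * C1 * (\<integral>x. J x \<partial>\<mu>)" by simp
    ultimately show ?thesis using bp[of n] by (simp only: distrib_right mult_1)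
  qed
  moreover have "continuous_on UNIV (\<lambda>x. G x * (x * \<Phi>' x))"
    by (intro continuous_intros G_continuous continuous_\<Phi>')
  moreover have "0 \<le> G x * (x * \<Phi>' x)" for x by (intro mult_nonneg_nonneg G_nonneg xd\<Phi>_nonneg)
  ultimately show "integrable \<mu> (\<lambda>x. G x * (x * \<Phi>' x))"
    "(\<integral>x. G x * (x * \<Phi>' x) \<partial>\<mu>) \<le> (2 * C1 + 1) * (\<integral>x. J x \<partial>\<mu>)"
    using integrable_if_bounded_on_intervals[of "\<lambda>x. G x * (x * \<Phi>' x)"] by blast+
qed

text \<open>
  A density on the line is bounded by its total variation. This replaces a logarithmic Sobolev
  inequality for the Lebesgue measure.
\<close>
lemma density_bound:
  "G x * w x \<le> (C2 + (2 * C1 + 1)) * (\<integral>x. J x \<partial>\<mu>)"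
proof -
  define q where "q = (\<lambda>x. C2 * J x + G x * (x * \<Phi>' x))"
  have qi: "integrable \<mu> q" unfolding q_def using J_bound(1) moment_bound(1) by simp
  have "(\<integral>x. q x \<partial>\<mu>) = C2 * (\<integral>x. J x \<partial>\<mu>) + (\<integral>x. G x * (x * \<Phi>' x) \<partial>\<mu>)"
    unfolding q_def using J_bound(1) moment_bound(1) by simp
  also have "\<dots> \<le> (C2 + (2 * C1 + 1)) * (\<integral>x. J x \<partial>\<mu>)"
    using moment_bound(2) by (simp add: algebra_simps)
  finally have qle: "(\<integral>x. q x \<partial>\<mu>) \<le> (C2 + (2 * C1 + 1)) * (\<integral>x. J x \<partial>\<mu>)" .
  have ql: "integrable lborel (\<lambda>x. q x * w x)"
    using qi integrable_\<mu>_iff integrable_\<mu>_measurable by blast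
  have q0: "0 \<le> q x" for x
    unfolding q_def using C2_nonneg J_nonneg G_nonneg xd\<Phi>_nonneg by simp
  let ?\<rho> = "\<lambda>x. G x * w x" and ?\<rho>' = "\<lambda>x. G' x * w x + G x * (- \<Phi>' x * w x)"
  have \<rho>: "ac_derivative ?\<rho> ?\<rho>'"
    by (intro ac_derivative_mult G ac_derivative_C1[OF w_deriv] continuous_intros continuous_\<Phi>' continuous_w)
  have \<rho>'_le: "\<bar>?\<rho>' x\<bar> \<le> q x * w x" for x
  proof -
    have "\<bar>G' x\<bar> \<le> N / c * J x"
    proof (cases "2 < f x")
      case True
      let ?y = "f' x / f x"
      have "\<bar>G' x\<bar> \<le> N * cut (f x) ^ k * \<bar>?y\<bar> * (f x)\<^sup>2" by (rule abs_G'_le[OF True])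
      also have "\<dots> \<le> N * 1 * (1 / c * (1 + H ?y)) * (f x)\<^sup>2"
        using N_pos cut_le_1[OF f(2), of x] abs_le_H[of ?y]
        by (intro mult_right_mono mult_mono power_le_one) auto
      also have "\<dots> = N / c * J x" using True by (simp add: J_def)
      finally show ?thesis .
    next
      case False
      then show ?thesis using G'_eq_0[of x] N_pos c_pos J_nonneg[of x] by simp
    qed
    moreover have "G x * \<bar>\<Phi>' x\<bar> \<le> G x * (x * \<Phi>' x) + \<Phi>' 1 * J x"
    proof -
      have "G x * \<bar>\<Phi>' x\<bar> \<le> G x * (x * \<Phi>' x + \<Phi>' 1)"
        by (intro mult_left_mono abs_\<Phi>'_le G_nonneg)
      moreover have "G x * \<Phi>' 1 \<le> J x * \<Phi>' 1"
        by (intro mult_right_mono G_le_J \<Phi>'_nonneg) simp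
      ultimately show ?thesis by (simp add: algebra_simps)
    qed
    ultimately have "\<bar>G' x\<bar> + G x * \<bar>\<Phi>' x\<bar> \<le> q x" by (simp add: q_def C2_def algebra_simps)
    moreover have "\<bar>G' x - G x * \<Phi>' x\<bar> \<le> \<bar>G' x\<bar> + G x * \<bar>\<Phi>' x\<bar>"
      using abs_triangle_ineq4[of "G' x" "G x * \<Phi>' x"] G_nonneg[of x] by (simp add: abs_mult)
    ultimately have "\<bar>G' x - G x * \<Phi>' x\<bar> * w x \<le> q x * w x"
      by (intro mult_right_mono) auto
    moreover have "?\<rho>' x = (G' x - G x * \<Phi>' x) * w x" by (simp add: algebra_simps)
    ultimately show ?thesis by (simp add: abs_mult)
  qed
  have osc: "\<bar>?\<rho> b - ?\<rho> a\<bar> \<le> (\<integral>x. q x \<partial>\<mu>)" if "a \<le> b" for a b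
  proof -
    have FTC: "(?\<rho>' has_integral ?\<rho> b - ?\<rho> a) {a..b}" by (rule ac_derivative_has_integral[OF \<rho> that])
    have qU: "(\<lambda>x. q x * w x) integrable_on UNIV" by (rule integrable_on_lborel[OF ql])
    have "set_integrable lborel {a..b} (\<lambda>x. q x * w x)"
      using ql unfolding set_integrable_def by (intro integrable_mult_indicator) auto
    then have qab: "(\<lambda>x. q x * w x) integrable_on {a..b}" by (rule set_borel_integral_eq_integral(1))
    have "norm (integral {a..b} ?\<rho>') \<le> integral {a..b} (\<lambda>x. q x * w x)"
      using FTC qab \<rho>'_le by (intro integral_norm_bound_integral) (auto simp: has_integral_iff)
    also have "\<dots> \<le> integral UNIV (\<lambda>x. q x * w x)"
      using qab qU q0 by (intro integral_subset_le) auto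
    also have "\<dots> = (\<integral>x. q x \<partial>\<mu>)"
      using integral_lborel[OF ql] integral_\<mu>[OF integrable_\<mu>_measurable[OF qi]] by simp
    finally show ?thesis using integral_unique[OF FTC] by simp
  qed
  have Jl: "integrable lborel (\<lambda>x. J x * w x)"
    using J_bound(1) integrable_\<mu>_iff integrable_\<mu>_measurable by blast
  have "?\<rho> x \<le> (\<integral>x. q x \<partial>\<mu>)"
  proof (rule ccontr)
    assume "\<not> ?thesis"
    then have pos: "0 < ?\<rho> x - (\<integral>x. q x \<partial>\<mu>)" by simp
    have "?\<rho> x - (\<integral>x. q x \<partial>\<mu>) \<le> ?\<rho> y" for y
      using osc[of x y] osc[of y x] by (cases "x \<le> y") auto
    then have ge: "?\<rho> x - (\<integral>x. q x \<partial>\<mu>) \<le> J y * w y" for y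
      using mult_right_mono[OF G_le_J[of y], of "w y"] by (meson order_trans w_nonneg)
    have "integrable lborel (\<lambda>y::real. ?\<rho> x - (\<integral>x. q x \<partial>\<mu>))"
      by (rule Bochner_Integration.integrable_bound[OF Jl])
        (use ge pos in \<open>auto intro!: AE_I2 order_trans[OF _ abs_ge_self]\<close>)
    then show False using pos by (simp add: integrable_iff_bounded ennreal_mult_eq_top_iff)
  qed
  then show ?thesis using qle by linarith
qed

text \<open>
  With \<open>ln f \<le> f - 1\<close> the excess over \<open>f\<^sup>2 - 1\<close> is at most \<open>(2 f + 1) (f - 1)\<^sup>2\<close>.
\<close>
lemma entropy_density_small:
  assumes "f x \<le> 4"
  shows "(f x)\<^sup>2 * ln ((f x)\<^sup>2) \<le> (f x)\<^sup>2 - 1 + 9 * (f x - 1)\<^sup>2"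
proof -
  have "ln ((f x)\<^sup>2) = 2 * ln (f x)" using f(2)[of x] by (simp add: ln_realpow)
  also have "\<dots> \<le> 2 * (f x - 1)" using ln_le_minus_one[OF f(2)[of x]] by simp
  finally have "(f x)\<^sup>2 * ln ((f x)\<^sup>2) \<le> (f x)\<^sup>2 * (2 * (f x - 1))" by (intro mult_left_mono) auto
  also have "\<dots> = (f x)\<^sup>2 - 1 + (2 * f x + 1) * (f x - 1)\<^sup>2"
    by (simp add: power2_eq_square algebra_simps)
  also have "(2 * f x + 1) * (f x - 1)\<^sup>2 \<le> 9 * (f x - 1)\<^sup>2"
    using assms by (intro mult_right_mono) auto
  finally show ?thesis by simp
qed

text \<open>
  Where f is large, its square is comparable to G, and the logarithm of G is that of the density G w plus
  the potential plus a constant.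
\<close>
lemma ln_square_le:
  assumes "4 < f x"
  shows "ln ((f x)\<^sup>2) \<le> C3 + (G x * w x + x * \<Phi>' x)"
proof -
  have f0: "0 < (f x)\<^sup>2" using f(2)[of x] by simp
  have ge: "(f x)\<^sup>2 \<le> 2 ^ Suc k * G x" unfolding G_def by (rule trunc_sq_ge[OF assms])
  have G0: "0 < G x"
  proof (rule ccontr)
    assume "\<not> 0 < G x"
    then have "G x = 0" using G_nonneg[of x] by simp
    then show False using ge f0 by simp
  qed
  have "ln ((f x)\<^sup>2) \<le> ln (2 ^ Suc k * G x)"
    by (rule ln_le_cancel_iff[THEN iffD2]) (use ge f0 G0 in auto)
  also have "\<dots> = real (Suc k) * ln 2 + ln (G x)"
    using G0 by (subst ln_mult) (auto simp: ln_realpow simp del: power_Suc)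
  also have "ln (G x) = ln (G x * w x) + \<Phi> x + ln (Z_const \<Phi>)"
  proof -
    have "ln (w x) = - \<Phi> x - ln (Z_const \<Phi>)" unfolding w_def using Z_pos by (simp add: ln_div)
    then show ?thesis using G0 w_pos[of x] by (simp add: ln_mult)
  qed
  also have "ln (G x * w x) \<le> G x * w x"
    using ln_le_minus_one[of "G x * w x"] G0 w_pos[of x] by simp
  also have "\<Phi> x \<le> x * \<Phi>' x + \<Phi> M" by (rule \<Phi>_le_xd\<Phi>)
  finally show ?thesis unfolding C3_def by linarith
qed

text \<open>
  The two bounds of the entropy density are combined into one integrable majorant b. The term T times the
  square of f, with T the bound of the density G w, contributes only T, because the square of f has
  integral 1.
\<close>
lemma entropy_bound:
  shows "integrable \<mu> (\<lambda>x. (f x)\<^sup>2 * ln ((f x)\<^sup>2))"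
    "(\<integral>x. (f x)\<^sup>2 * ln ((f x)\<^sup>2) \<partial>\<mu>) \<le> C4 * I"
proof -
  define T where "T = (C2 + (2 * C1 + 1)) * (\<integral>x. J x \<partial>\<mu>)"
  have T0: "0 \<le> T" using density_bound[of 0] G_nonneg[of 0] unfolding T_def
    by (meson mult_nonneg_nonneg order_trans w_nonneg)
  define b where "b = (\<lambda>x. (f x)\<^sup>2 - 1 + 9 * (f x - 1)\<^sup>2 + C3 * J x + T * (f x)\<^sup>2
      + 2 ^ Suc k * (G x * (x * \<Phi>' x)))"
  have bi: "integrable \<mu> b"
    unfolding b_def using f_square distance_to_one(1) J_bound(1) moment_bound(1) by simp
  have C3: "0 \<le> C3" by (simp add: C3_def)
  have up: "(f x)\<^sup>2 * ln ((f x)\<^sup>2) \<le> b x" for x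
  proof -
    have GS: "0 \<le> G x * (x * \<Phi>' x)" by (intro mult_nonneg_nonneg G_nonneg xd\<Phi>_nonneg)
    then have rest: "0 \<le> 2 ^ Suc k * (G x * (x * \<Phi>' x))" by (rule mult_nonneg_nonneg[rotated]) simp
    have CJ: "0 \<le> C3 * J x" and TF: "0 \<le> T * (f x)\<^sup>2" using C3 T0 J_nonneg[of x] by auto
    show ?thesis
    proof (cases "f x \<le> 4")
      case True
      then show ?thesis using entropy_density_small[OF True] rest CJ TF unfolding b_def by linarith
    next
      case False
      then have f4: "4 < f x" by simp
      have "ln ((f x)\<^sup>2) \<le> C3 + (T + x * \<Phi>' x)"
        using ln_square_le[OF f4] density_bound[of x] unfolding T_def by linarith
      then have "(f x)\<^sup>2 * ln ((f x)\<^sup>2) \<le> (f x)\<^sup>2 * (C3 + (T + x * \<Phi>' x))" by (intro mult_left_mono) auto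
      also have "\<dots> = C3 * (f x)\<^sup>2 + T * (f x)\<^sup>2 + (f x)\<^sup>2 * (x * \<Phi>' x)" by (simp add: algebra_simps)
      also have "(f x)\<^sup>2 * (x * \<Phi>' x) \<le> (2 ^ Suc k * G x) * (x * \<Phi>' x)"
        unfolding G_def by (intro mult_right_mono trunc_sq_ge f4 xd\<Phi>_nonneg)
      also have "C3 * (f x)\<^sup>2 \<le> C3 * J x" using f4 C3 by (intro mult_left_mono square_le_J) auto
      finally have "(f x)\<^sup>2 * ln ((f x)\<^sup>2) \<le> C3 * J x + T * (f x)\<^sup>2 + 2 ^ Suc k * (G x * (x * \<Phi>' x))"
        by (simp only: mult.assoc)
      moreover have "1 \<le> (f x)\<^sup>2" using f4 by (intro one_le_power) auto
      moreover have "0 \<le> 9 * (f x - 1)\<^sup>2" by simp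
      ultimately show ?thesis unfolding b_def by linarith
    qed
  qed
  have low: "- 1 \<le> (f x)\<^sup>2 * ln ((f x)\<^sup>2)" for x
  proof -
    have f0: "0 < (f x)\<^sup>2" using f(2)[of x] by simp
    have "ln (1 / (f x)\<^sup>2) \<le> 1 / (f x)\<^sup>2 - 1" by (rule ln_le_minus_one) (use f0 in simp)
    then have "1 - 1 / (f x)\<^sup>2 \<le> ln ((f x)\<^sup>2)" using f0 by (simp add: ln_div)
    then have "(f x)\<^sup>2 * (1 - 1 / (f x)\<^sup>2) \<le> (f x)\<^sup>2 * ln ((f x)\<^sup>2)" by (intro mult_left_mono) auto
    moreover have "(f x)\<^sup>2 * (1 - 1 / (f x)\<^sup>2) = (f x)\<^sup>2 - 1" using f0 by (simp add: right_diff_distrib)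
    ultimately show ?thesis using f0 by linarith
  qed
  show int: "integrable \<mu> (\<lambda>x. (f x)\<^sup>2 * ln ((f x)\<^sup>2))"
  proof (rule Bochner_Integration.integrable_bound)
    show "integrable \<mu> (\<lambda>x. \<bar>b x\<bar> + 1)" using bi by simp
    have "\<bar>(f x)\<^sup>2 * ln ((f x)\<^sup>2)\<bar> \<le> \<bar>b x\<bar> + 1" for x using up[of x] low[of x] by linarith
    then show "AE x in \<mu>. norm ((f x)\<^sup>2 * ln ((f x)\<^sup>2)) \<le> norm (\<bar>b x\<bar> + 1)" by (intro AE_I2) simp
  qed measurable
  have "(\<integral>x. (f x)\<^sup>2 * ln ((f x)\<^sup>2) \<partial>\<mu>) \<le> (\<integral>x. b x \<partial>\<mu>)" by (rule integral_mono[OF int bi up])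
  also have "\<dots> = 9 * (\<integral>x. (f x - 1)\<^sup>2 \<partial>\<mu>) + C3 * (\<integral>x. J x \<partial>\<mu>) + T
      + 2 ^ Suc k * (\<integral>x. G x * (x * \<Phi>' x) \<partial>\<mu>)"
    unfolding b_def using f_square distance_to_one(1) J_bound(1) moment_bound(1) normalized
    by (simp del: power_Suc)
  also have "\<dots> \<le> 9 * (c0 * I) + C3 * (\<integral>x. J x \<partial>\<mu>) + T + 2 ^ Suc k * ((2 * C1 + 1) * (\<integral>x. J x \<partial>\<mu>))"
    using distance_to_one(2) moment_bound(2) C3 by (intro add_mono mult_left_mono) auto
  also have "\<dots> = 9 * c0 * I + (C3 + (C2 + (2 * C1 + 1)) + 2 ^ Suc k * (2 * C1 + 1)) * (\<integral>x. J x \<partial>\<mu>)"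
    by (simp add: T_def algebra_simps)
  also have "\<dots> \<le> 9 * c0 * I + (C3 + (C2 + (2 * C1 + 1)) + 2 ^ Suc k * (2 * C1 + 1)) * ((4 * c0 + 1) * I)"
  proof (intro add_left_mono mult_left_mono J_bound(2))
    show "0 \<le> C3 + (C2 + (2 * C1 + 1)) + 2 ^ Suc k * (2 * C1 + 1)"
      using C1_nonneg C2_nonneg C3 by (intro add_nonneg_nonneg mult_nonneg_nonneg) auto
  qed
  also have "\<dots> = C4 * I" by (simp add: C4_def algebra_simps)
  finally show "(\<integral>x. (f x)\<^sup>2 * ln ((f x)\<^sup>2) \<partial>\<mu>) \<le> C4 * I" .
qed

end

context intermediate_growth
begin

text \<open>
  Both sides of the inequality are homogeneous of degree two in f, and the energy density depends on
  the logarithmic derivative, which scaling does not change.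
\<close>
lemma Ent_le_energy:
  assumes f: "ac_derivative f f'" "\<And>x. 0 < f x"
    and energy: "integrable \<mu> (\<lambda>x. H (f' x / f x) * (f x)\<^sup>2)"
  shows "Ent \<mu> (\<lambda>x. (f x)\<^sup>2) \<le> ereal (C4 * (\<integral>x. H (f' x / f x) * (f x)\<^sup>2 \<partial>\<mu>))"
proof -
  let ?I = "\<integral>x. H (f' x / f x) * (f x)\<^sup>2 \<partial>\<mu>"
  define m where "m = (\<integral>x. (f x)\<^sup>2 \<partial>\<mu>)"
  note f2 = integrable_square_if_energy(1)[OF f energy]
  have "m \<noteq> 0"
  proof
    assume "m = 0"
    then have "AE x in \<mu>. (f x)\<^sup>2 = 0"
      unfolding m_def using integral_nonneg_eq_0_iff_AE[OF f2] by simp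
    then have "AE x in \<mu>. False" by (rule AE_mp) (use f(2) in \<open>auto intro!: AE_I2 simp: less_le\<close>)
    then have "UNIV \<in> null_sets \<mu>" using AE_iff_null_sets[of UNIV \<mu>] by simp
    from measure_eq_0_null_sets[OF this] show False by simp
  qed
  moreover have "0 \<le> m" unfolding m_def by simp
  ultimately have m: "0 < m" by simp
  define s where "s = sqrt m"
  have s: "0 < s" "s\<^sup>2 = m" using m by (auto simp: s_def)
  define g where "g = (\<lambda>x. f x / s)"
  define g' where "g' = (\<lambda>x. f' x / s)"
  have g2: "(g x)\<^sup>2 = (f x)\<^sup>2 / m" for x by (simp add: g_def power_divide s)
  have ratio: "g' x / g x = f' x / f x" for x using s by (simp add: g_def g'_def)
  have Hg: "H (g' x / g x) * (g x)\<^sup>2 = H (f' x / f x) * (f x)\<^sup>2 / m" for x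
    by (simp add: ratio g2)
  have "finite_energy \<Phi> \<Phi>' \<Phi>'' M \<epsilon> g g'"
  proof unfold_locales
    have "ac_derivative (\<lambda>x. f x / s) (\<lambda>x. 1 / s * f' x)"
      by (rule ac_derivative_compose[OF f(1), of UNIV "\<lambda>y. y / s" "\<lambda>_. 1 / s"])
        (use s(1) in \<open>auto intro!: derivative_eq_intros\<close>)
    then show "ac_derivative g g'" by (simp add: g_def g'_def)
    show "0 < g x" for x using f(2) s by (simp add: g_def)
    show "integrable \<mu> (\<lambda>x. H (g' x / g x) * (g x)\<^sup>2)" unfolding Hg using energy by simp
    show "(\<integral>x. (g x)\<^sup>2 \<partial>\<mu>) = 1" unfolding g2 using m by (simp add: m_def)
  qed
  then interpret g: finite_energy \<Phi> \<Phi>' \<Phi>'' M \<epsilon> g g' .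
  have gI: "g.I = ?I / m" unfolding g.I_def Hg by simp
  have pt: "(f x)\<^sup>2 * ln ((f x)\<^sup>2) = m * ((g x)\<^sup>2 * ln ((g x)\<^sup>2)) + ln m * (f x)\<^sup>2" for x
  proof -
    have "ln ((g x)\<^sup>2) = ln ((f x)\<^sup>2) - ln m"
      unfolding g2 using f(2)[of x] m by (simp add: ln_div)
    moreover have "m * ((g x)\<^sup>2 * ln ((g x)\<^sup>2)) = (f x)\<^sup>2 * ln ((g x)\<^sup>2)"
      using m unfolding g2[of x] by simp
    ultimately show ?thesis by (simp add: right_diff_distrib mult.commute)
  qed
  have int: "integrable \<mu> (\<lambda>x. (f x)\<^sup>2 * ln ((f x)\<^sup>2))"
    unfolding pt using g.entropy_bound(1) f2 by simp
  have "(\<integral>x. (f x)\<^sup>2 * ln ((f x)\<^sup>2) \<partial>\<mu>) - m * ln m = m * (\<integral>x. (g x)\<^sup>2 * ln ((g x)\<^sup>2) \<partial>\<mu>)"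
    unfolding pt using g.entropy_bound(1) f2 by (simp add: m_def)
  also have "\<dots> \<le> m * (C4 * g.I)" using g.entropy_bound(2) m by (intro mult_left_mono) auto
  also have "\<dots> = C4 * ?I" unfolding gI using m by simp
  finally show ?thesis using int f2 by (simp add: Ent_def m_def)
qed

end

section \<open>The modified logarithmic Sobolev inequality\<close>

context intermediate_growth
begin

text \<open>
  The integrand is nonnegative, so no negative part occurs, and deriv f may be replaced by the Borel
  version of the derivative.
\<close>
lemma ereal_integral_H_fun:
  assumes f: "ac_derivative f f'" and eq: "AE x in lborel. deriv f x = f' x"
  shows "ereal_integral \<mu> (\<lambda>x. H_fun \<Phi> B D (deriv f x / f x) * ereal ((f x)\<^sup>2))
    = enn2ereal (\<integral>\<^sup>+x. ennreal (H (f' x / f x) * (f x)\<^sup>2) \<partial>\<mu>)"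
proof -
  have val: "H_fun \<Phi> B D (deriv f x / f x) * ereal ((f x)\<^sup>2) = ereal (H (deriv f x / f x) * (f x)\<^sup>2)" for x
    by (simp add: H_fun_eq)
  have nonneg: "0 \<le> H (deriv f x / f x) * (f x)\<^sup>2" for x
    by (intro mult_nonneg_nonneg H_nonneg) simp
  have "(\<integral>\<^sup>+x. ennreal (H (deriv f x / f x) * (f x)\<^sup>2) \<partial>\<mu>) = (\<integral>\<^sup>+x. ennreal (H (f' x / f x) * (f x)\<^sup>2) \<partial>\<mu>)"
    by (rule nn_integral_cong_AE) (use AE_\<mu>[OF eq] in eventually_elim, simp)
  moreover have "e2ennreal (- ereal (H (deriv f x / f x) * (f x)\<^sup>2)) = 0" for x
    using nonneg[of x] by (simp add: ennreal_neg flip: ennreal_def)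
  ultimately show ?thesis
    unfolding ereal_integral_def val by (simp add: zero_ennreal.rep_eq flip: ennreal_def)
qed

end

theorem corollary1p3:
  fixes \<Phi> \<Phi>' \<Phi>'' :: "real \<Rightarrow> real" and M \<epsilon> :: real
  assumes even: "\<And>x. \<Phi> (- x) = \<Phi> x"
    and convex: "convex_on UNIV \<Phi>"
    and deriv1: "\<And>x. (\<Phi> has_real_derivative \<Phi>' x) (at x)"
    and deriv2: "\<And>x. (\<Phi>' has_real_derivative \<Phi>'' x) (at x)"
    and cont2: "continuous_on UNIV \<Phi>''"
    and M: "M > 0" "\<Phi> M > 0"
    and eps: "0 < \<epsilon>" "\<epsilon> \<le> 1/2"
    and growth: "\<And>x. x \<ge> M \<Longrightarrow>
          (1 + \<epsilon>) * \<Phi> x \<le> x * \<Phi>' x \<and> x * \<Phi>' x \<le> (2 - \<epsilon>) * \<Phi> x"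
  shows "\<exists>A B D :: real. A \<ge> 0 \<and> B \<ge> 0 \<and> D \<ge> 0 \<and>
    (\<forall>f :: real \<Rightarrow> real. locally_absolutely_continuous f \<and> (\<forall>x. f x > 0) \<longrightarrow>
       Ent (mu_measure \<Phi>) (\<lambda>x. (f x)\<^sup>2)
         \<le> ereal A * ereal_integral (mu_measure \<Phi>)
              (\<lambda>x. H_fun \<Phi> B D (deriv f x / f x) * ereal ((f x)\<^sup>2)))"
proof -
  interpret intermediate_growth \<Phi> \<Phi>' \<Phi>'' M \<epsilon>
    by unfold_locales (fact even convex deriv1 deriv2 M eps growth)+
  have ineq: "Ent \<mu> (\<lambda>x. (f x)\<^sup>2)
      \<le> ereal (C4 + 1) * ereal_integral \<mu> (\<lambda>x. H_fun \<Phi> B D (deriv f x / f x) * ereal ((f x)\<^sup>2))"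
    if ac: "locally_absolutely_continuous f" and pos: "\<And>x. 0 < f x" for f
  proof -
    obtain f' where f: "ac_derivative f f'" "AE x in lborel. deriv f x = f' x"
      using locally_absolutely_continuous_imp_ac_derivative[OF ac] by blast
    let ?h = "\<lambda>x. H (f' x / f x) * (f x)\<^sup>2"
    have nonneg: "0 \<le> ?h x" for x by (intro mult_nonneg_nonneg H_nonneg) simp
    have [measurable]: "f \<in> borel_measurable borel" "f' \<in> borel_measurable borel"
      using borel_measurable_continuous_onI[OF ac_derivative_continuous[OF f(1)]]
        ac_derivative_measurable[OF f(1)] by auto
    note energy = ereal_integral_H_fun[OF f]
    \<comment> \<open>If the energy is infinite, then so is the right-hand side, because C4 + 1 is positive.\<close>
    show ?thesis
    proof (cases "integrable \<mu> ?h")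
      case True
      have "0 \<le> (\<integral>x. ?h x \<partial>\<mu>)" using nonneg by simp
      have "Ent \<mu> (\<lambda>x. (f x)\<^sup>2) \<le> ereal (C4 * (\<integral>x. ?h x \<partial>\<mu>))"
        by (rule Ent_le_energy[OF f(1) pos True])
      also have "\<dots> \<le> ereal ((C4 + 1) * (\<integral>x. ?h x \<partial>\<mu>))"
        using \<open>0 \<le> (\<integral>x. ?h x \<partial>\<mu>)\<close> by (simp add: distrib_right)
      also have "\<dots> = ereal (C4 + 1) * enn2ereal (\<integral>\<^sup>+x. ennreal (?h x) \<partial>\<mu>)"
        using nn_integral_eq_integral[OF True] nonneg \<open>0 \<le> (\<integral>x. ?h x \<partial>\<mu>)\<close>
        by (simp add: enn2ereal_ennreal)
      finally show ?thesis unfolding energy .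
    next
      case False
      have "?h \<in> borel_measurable \<mu>" by measurable
      have "\<not> (\<integral>\<^sup>+x. ennreal (?h x) \<partial>\<mu>) < \<infinity>"
        using False integrableI_nonneg[OF \<open>?h \<in> borel_measurable \<mu>\<close> AE_I2[OF nonneg]] by blast
      then have "(\<integral>\<^sup>+x. ennreal (?h x) \<partial>\<mu>) = \<infinity>" by (simp add: less_top[symmetric])
      then show ?thesis unfolding energy using C4_nonneg by simp
    qed
  qed
  show ?thesis
  proof (rule exI[of _ "C4 + 1"], rule exI[of _ B], rule exI[of _ D], intro conjI allI impI)
    show "0 \<le> C4 + 1" "0 \<le> B" "0 \<le> D" using C4_nonneg B_pos D_pos by auto
  qed (rule ineq, auto)
qed

end
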